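(* Let $\mathcal{S}\subset\mathbb{Z}\times\mathbb{Z}$ be a finite set with nonzero weights $(w_s)_{s\in\mathcal{S}}$ in $\mathbb{C}$, and assume that the Laurent polynomial $S(X,Y)=\sum_{s\in\mathcal{S}}w_sX^{s_x}Y^{s_y}$ is not univariate. If the orbit $\mathcal{O}$ of the walk is finite, then the pair $(x,y)$ admits a decoupling $(\gamma_x,\gamma_y,\alpha)$ in the orbit; that is, there exist $0$-chains $\gamma_x,\gamma_y,\alpha$ of $\mathcal{O}$ with $(x,y)=\gamma_x+\gamma_y+\alpha$ such that for every regular fraction $H(X,Y,t)\in\mathbb{C}(X,Y,t)$: (1) $H_{\gamma_x}\in k(x)$ and $H_{\gamma_y}\in k(y)$, and (2) $H_\alpha=0$ whenever $H$ admits a Galois decoupling.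
   Context: Here $x,y$ are two indeterminates, $\mathbb{K}=\overline{\mathbb{C}(x,y)}$ is an algebraic closure of $\mathbb{C}(x,y)$, $k=\mathbb{C}(S(x,y))$, and $X,Y,t$ are further indeterminates. "Not univariate" means that both variables $X$ and $Y$ actually occur in $S(X,Y)$. Orbit: two pairs $(u,v),(u',v')\in\mathbb{K}\times\mathbb{K}$ are adjacent, written $\sim$, if $S(u,v)=S(u',v')$ and ($u=u'$ or $v=v'$); $\sim^*$ is the transitive closure of $\sim$. The orbit $\mathcal{O}$ is the set of pairs $(u,v)\in\mathbb{K}\times\mathbb{K}$ with $(u,v)\sim^*(x,y)$. The field $k(\mathcal{O})$ is the subfield of $\mathbb{K}$ generated over $k$ by the coordinates of all pairs in $\mathcal{O}$. Regular fractions: the kernel polynomial is $\widetilde{K}(X,Y,t)=X^{m_x}Y^{m_y}(1-tS(X,Y))$, where $m_x=\max(0,-\min_{s\in\mathcal{S}}s_x)$ and $m_y=\max(0,-\min_{s\in\mathcal{S}}s_y)$; it is irreducible in $\mathbb{C}[X,Y,t]$. A fraction $H(X,Y,t)\in\mathbb{C}(X,Y,t)$ (in lowest terms) is regular if its denominator is not divisible by $\widetilde{K}$. Evaluation: for a regular fraction $H$ and $(u,v)\in\mathcal{O}$, set $H_{(u,v)}=H(u,v,1/S(x,y))\in k(\mathcal{O})$. A $0$-chain is a (finite) formal $\mathbb{C}$-linear combination $c=\sum_{(u,v)\in\mathcal{O}}c_{u,v}(u,v)$ of pairs of the orbit, and $H_c=\sum_{(u,v)\in\mathcal{O}}c_{u,v}H_{(u,v)}$.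 In the equality $(x,y)=\gamma_x+\gamma_y+\alpha$, $(x,y)$ is viewed as the $0$-chain given by the single vertex $(x,y)$. Galois decoupling: a regular fraction $H(X,Y,t)$ admits a Galois decoupling if there exist $F(X,t)\in\mathbb{C}(X,t)$ and $G(Y,t)\in\mathbb{C}(Y,t)$ such that $H_{(x,y)}=F_{(x,y)}+G_{(x,y)}$. *)

theory Defs
  imports
    "HOL-Algebra.Algebraic_Closure_Type"
    "HOL-Algebra.Generated_Fields"
    "HOL-Library.Poly_Mapping"
begin

section \<open>Fields\<close>

text \<open>
  \<open>K\<close> is the algebraic closure of the field of fractions of \<open>\<complex>[x][y]\<close>. Polynomials in
  \<open>X, Y, t\<close> are nested as \<open>\<complex>[X][Y][t]\<close>, with \<open>X\<close> innermost.
\<close>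

type_synonym K = "complex poly poly fract alg_closure"
type_synonym poly3 = "complex poly poly poly"
type_synonym frac3 = "complex poly poly poly fract"

definition constK :: "complex \<Rightarrow> K" where
  "constK c = to_ac (to_fract [:[:c:]:])"

definition xK :: K where
  "xK = to_ac (to_fract [:[:0, 1:]:])"

definition yK :: K where
  "yK = to_ac (to_fract [:0, 1:])"

definition const3 :: "complex \<Rightarrow> frac3" where
  "const3 c = to_fract [:[:[:c:]:]:]"

definition X3 :: frac3 where
  "X3 = to_fract [:[:[:0, 1:]:]:]"

definition Y3 :: frac3 where
  "Y3 = to_fract [:[:0, 1:]:]"

definition t3 :: frac3 where
  "t3 = to_fract [:0, 1:]"

definition subfield_gen :: "'a::field set \<Rightarrow> 'a set" where
  "subfield_gen A = generate_field ring_of_type_algebra A"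


section \<open>The step polynomial and the orbit\<close>

text \<open>
  The value \<open>S(u, v)\<close> of the Laurent polynomial with support \<open>S\<close> and weights \<open>w\<close>, for
  \<open>u, v\<close> in a field into which the complex numbers are embedded by \<open>emb\<close>. Although
  \<open>0 powi n = 0\<close> for negative \<open>n\<close>, no such junk value enters the orbit below: when \<open>S\<close> is
  not univariate, all coordinates of pairs in the orbit are transcendental over the
  complex numbers.
\<close>

definition laurent_eval ::
  "(complex \<Rightarrow> 'a::field) \<Rightarrow> (int \<times> int) set \<Rightarrow> (int \<times> int \<Rightarrow> complex) \<Rightarrow> 'a \<Rightarrow> 'a \<Rightarrow> 'a" where
  "laurent_eval emb S w u v = (\<Sum>s\<in>S. emb (w s) * u powi fst s * v powi snd s)"

definition not_univariate :: "(int \<times> int) set \<Rightarrow> bool" where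
  "not_univariate S \<longleftrightarrow> (\<exists>s\<in>S. fst s \<noteq> 0) \<and> (\<exists>s\<in>S. snd s \<noteq> 0)"

definition adjacent ::
  "(int \<times> int) set \<Rightarrow> (int \<times> int \<Rightarrow> complex) \<Rightarrow> K \<times> K \<Rightarrow> K \<times> K \<Rightarrow> bool" where
  "adjacent S w p q \<longleftrightarrow>
     laurent_eval constK S w (fst p) (snd p) = laurent_eval constK S w (fst q) (snd q) \<and>
     (fst p = fst q \<or> snd p = snd q)"

definition orbit :: "(int \<times> int) set \<Rightarrow> (int \<times> int \<Rightarrow> complex) \<Rightarrow> (K \<times> K) set" where
  "orbit S w = {p. (adjacent S w)\<^sup>+\<^sup>+ p (xK, yK)}"

definition base_field :: "(int \<times> int) set \<Rightarrow> (int \<times> int \<Rightarrow> complex) \<Rightarrow> K set" where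
  "base_field S w = subfield_gen (range constK \<union> {laurent_eval constK S w xK yK})"


section \<open>Regular fractions and their evaluation\<close>

definition shift_x :: "(int \<times> int) set \<Rightarrow> int" where
  "shift_x S = max 0 (- Min (fst ` S))"

definition shift_y :: "(int \<times> int) set \<Rightarrow> int" where
  "shift_y S = max 0 (- Min (snd ` S))"

definition kernel_poly :: "(int \<times> int) set \<Rightarrow> (int \<times> int \<Rightarrow> complex) \<Rightarrow> poly3" where
  "kernel_poly S w =
     [:monom (monom 1 (nat (shift_x S))) (nat (shift_y S)),
       - (\<Sum>s\<in>S. monom (monom (w s) (nat (fst s + shift_x S))) (nat (snd s + shift_y S))):]"

text \<open>
  The kernel polynomial is \<open>X\<^sup>m Y\<^sup>n (1 - t S(X, Y))\<close> with \<open>m\<close> and \<open>n\<close> the two shifts.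
\<close>

lemma to_fract_monom3:
  "to_fract [:monom (monom c m) n:] = const3 c * X3 ^ m * Y3 ^ n"
proof (induction n)
  case 0
  show ?case
  proof (induction m)
    case 0
    show ?case by (simp add: const3_def monom_0)
  next
    case (Suc m)
    have "[:monom (monom c (Suc m)) 0:] = [:[:[:0, 1:]:]:] * [:monom (monom c m) 0:]"
      by (simp add: monom_Suc monom_0)
    then have "to_fract [:monom (monom c (Suc m)) 0:] = X3 * to_fract [:monom (monom c m) 0:]"
      by (simp only: to_fract_mult X3_def)
    with Suc show ?case by (simp add: mult_ac)
  qed
next
  case (Suc n)
  have "[:monom (monom c m) (Suc n):] = [:[:0, 1:]:] * [:monom (monom c m) n:]"
    by (simp add: monom_Suc)
  then have "to_fract [:monom (monom c m) (Suc n):] = Y3 * to_fract [:monom (monom c m) n:]"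
    by (simp only: to_fract_mult Y3_def)
  with Suc show ?case by (simp add: mult_ac)
qed

lemma to_fract_const_sum: "to_fract [:\<Sum>s\<in>A. f s:] = (\<Sum>s\<in>A. to_fract [:f s:])"
proof (induction A rule: infinite_finite_induct)
  case (insert a A)
  have "[:\<Sum>s\<in>insert a A. f s:] = [:f a:] + [:\<Sum>s\<in>A. f s:]"
    using insert.hyps by simp
  then have "to_fract [:\<Sum>s\<in>insert a A. f s:] = to_fract [:f a:] + to_fract [:\<Sum>s\<in>A. f s:]"
    by (simp only: to_fract_add)
  with insert show ?case
    by simp
qed auto

lemma to_fract_kernel_poly:
  assumes "finite S"
  shows "to_fract (kernel_poly S w) =
    X3 powi shift_x S * Y3 powi shift_y S * (1 - t3 * laurent_eval const3 S w X3 Y3)"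
proof -
  let ?m = "shift_x S" and ?n = "shift_y S"
  have nz: "X3 \<noteq> 0" "Y3 \<noteq> 0"
    by (simp_all add: X3_def Y3_def)
  have shift: "?m \<ge> 0" "?n \<ge> 0"
    by (simp_all add: shift_x_def shift_y_def)
  have one: "const3 1 = 1"
    by (simp add: const3_def flip: one_pCons)
  have pow: "z ^ nat i = z powi i" if "i \<ge> 0" for z :: frac3 and i
    using that by (simp add: power_int_def)
  define M where "M = monom (monom (1::complex) (nat ?m)) (nat ?n)"
  define P where
    "P = (\<Sum>s\<in>S. monom (monom (w s) (nat (fst s + ?m))) (nat (snd s + ?n)))"
  have "kernel_poly S w = [:M:] - [:0, 1:] * [:P:]"
    by (simp add: kernel_poly_def M_def P_def)
  then have "to_fract (kernel_poly S w) = to_fract [:M:] - t3 * to_fract [:P:]"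
    by (simp only: to_fract_diff to_fract_mult t3_def)
  also have "to_fract [:M:] = X3 powi ?m * Y3 powi ?n"
    using shift by (simp add: M_def to_fract_monom3 one pow)
  also have "to_fract [:P:] = X3 powi ?m * Y3 powi ?n * laurent_eval const3 S w X3 Y3"
    unfolding P_def to_fract_const_sum to_fract_monom3 laurent_eval_def sum_distrib_left
  proof (rule sum.cong)
    fix s assume s: "s \<in> S"
    have "Min (fst ` S) \<le> fst s" "Min (snd ` S) \<le> snd s"
      using s assms by auto
    then have "fst s + ?m \<ge> 0" "snd s + ?n \<ge> 0"
      by (auto simp: shift_x_def shift_y_def)
    then show "const3 (w s) * X3 ^ nat (fst s + ?m) * Y3 ^ nat (snd s + ?n) =
      X3 powi ?m * Y3 powi ?n * (const3 (w s) * X3 powi fst s * Y3 powi snd s)"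
      using nz by (simp add: pow power_int_add mult_ac)
  qed simp
  finally show ?thesis
    by (simp add: algebra_simps)
qed

definition regular :: "(int \<times> int) set \<Rightarrow> (int \<times> int \<Rightarrow> complex) \<Rightarrow> frac3 \<Rightarrow> bool" where
  "regular S w H \<longleftrightarrow> \<not> kernel_poly S w dvd snd (quot_of_fract H)"

definition poly3_eval :: "poly3 \<Rightarrow> K \<Rightarrow> K \<Rightarrow> K \<Rightarrow> K" where
  "poly3_eval P u v z =
     poly (map_poly (\<lambda>Q. poly (map_poly (\<lambda>R. poly (map_poly constK R) u) Q) v) P) z"

definition frac_eval ::
  "(int \<times> int) set \<Rightarrow> (int \<times> int \<Rightarrow> complex) \<Rightarrow> frac3 \<Rightarrow> K \<times> K \<Rightarrow> K" where
  "frac_eval S w H p =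
     (let z = 1 / laurent_eval constK S w xK yK
      in poly3_eval (fst (quot_of_fract H)) (fst p) (snd p) z /
         poly3_eval (snd (quot_of_fract H)) (fst p) (snd p) z)"


section \<open>Chains and decouplings\<close>

definition zero_chains ::
  "(int \<times> int) set \<Rightarrow> (int \<times> int \<Rightarrow> complex) \<Rightarrow> ((K \<times> K) \<Rightarrow>\<^sub>0 complex) set" where
  "zero_chains S w = {c. Poly_Mapping.keys c \<subseteq> orbit S w}"

definition chain_eval ::
  "(int \<times> int) set \<Rightarrow> (int \<times> int \<Rightarrow> complex) \<Rightarrow> frac3 \<Rightarrow> ((K \<times> K) \<Rightarrow>\<^sub>0 complex) \<Rightarrow> K" where
  "chain_eval S w H c =
     (\<Sum>p\<in>Poly_Mapping.keys c. constK (Poly_Mapping.lookup c p) * frac_eval S w H p)"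

text \<open>
  The fractions \<open>F\<close> and \<open>G\<close> are automatically regular when \<open>S\<close> is not univariate, since
  then the kernel polynomial involves both \<open>X\<close> and \<open>Y\<close>.
\<close>

definition galois_decoupling ::
  "(int \<times> int) set \<Rightarrow> (int \<times> int \<Rightarrow> complex) \<Rightarrow> frac3 \<Rightarrow> bool" where
  "galois_decoupling S w H \<longleftrightarrow>
     (\<exists>F\<in>subfield_gen (range const3 \<union> {X3, t3}).
      \<exists>G\<in>subfield_gen (range const3 \<union> {Y3, t3}).
        frac_eval S w H (xK, yK) = frac_eval S w F (xK, yK) + frac_eval S w G (xK, yK))"

definition decoupling ::
  "(int \<times> int) set \<Rightarrow> (int \<times> int \<Rightarrow> complex) \<Rightarrow>
   ((K \<times> K) \<Rightarrow>\<^sub>0 complex) \<Rightarrow> ((K \<times> K) \<Rightarrow>\<^sub>0 complex) \<Rightarrow> ((K \<times> K) \<Rightarrow>\<^sub>0 complex) \<Rightarrow> bool" where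
  "decoupling S w \<gamma>x \<gamma>y \<alpha> \<longleftrightarrow>
     \<gamma>x \<in> zero_chains S w \<and> \<gamma>y \<in> zero_chains S w \<and> \<alpha> \<in> zero_chains S w \<and>
     Poly_Mapping.single (xK, yK) 1 = \<gamma>x + \<gamma>y + \<alpha> \<and>
     (\<forall>H. regular S w H \<longrightarrow>
        chain_eval S w H \<gamma>x \<in> subfield_gen (base_field S w \<union> {xK}) \<and>
        chain_eval S w H \<gamma>y \<in> subfield_gen (base_field S w \<union> {yK}) \<and>
        (galois_decoupling S w H \<longrightarrow> chain_eval S w H \<alpha> = 0))"

end

(*
  For a function h on the orbit let R h be the sum of the sums of h along the row and along the
  column through a point. R is a symmetric operator, so R(m(R) d) = 0 for some real polynomial m
  with m(0) = 1, where d is the indicator of (x, y); write m(T) = 1 - q(T) T. By positivity,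
  alpha = m(R) d has vanishing row and column sums and so annihilates every f(u) + g(v). Writing
  R = R1 + R2 (rows and columns), gamma_x = q(R) R1 d and gamma_y = q(R) R2 d. By symmetry, the
  pairing of gamma_x with h is the value at (x, y) of R1 (q(R) h). This lies in k(x) for h = H,
  because every point of the orbit is a generic point of the plane: the sums R1 and R2 of a
  rational function over fibres are sums over all roots of one polynomial with coefficients in
  k(u), resp. k(v), hence again rational, by a formula that does not depend on the point.
  Genericity also carries a decoupling of H from (x, y) to the whole orbit, so no Galois group
  is needed.
*)

theory Submission
  imports Defs
begin

section \<open>Ring homomorphisms and evaluation of bivariate polynomials\<close>

text \<open>The normalisation \<open>m(0) = 1\<close> is the delicate point. Too many iterates of
  \<open>\<delta>\<close> under \<open>J\<close> are linearly dependent, but the dependency may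
  start at a positive power of \<open>J\<close>. For a symmetric real operator,
  \<open>J ^^ n\<close> with \<open>n > 0\<close> has the same kernel as \<open>J\<close>, so that
  power can be stripped off at the cost of one remaining application of \<open>J\<close>. This is
  why the coefficients are real and enter \<open>K\<close> only when paired with values of
  fractions. Genericity passes through \<open>z = S(x, y)\<close>, which is constant on the orbit:
  each coordinate of each orbit point is algebraically independent of \<open>z\<close>, and this is
  inherited by the neighbours. So the row through \<open>u\<close> lives over C(u, 1/z), which also
  explains the value 1/z of t. Since \<open>J\<close> is iterated, its result must again be one
  rational function valid on the whole orbit. Fibre sums are therefore computed once over the formal
  field C(X, t), with the minimal polynomial of Y over it, and specialised to the points
  afterwards.\<close>

definition is_hom :: "('a::comm_ring_1 \<Rightarrow> 'b::comm_ring_1) \<Rightarrow> bool" where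
  "is_hom f \<longleftrightarrow> f 0 = 0 \<and> f 1 = 1 \<and> (\<forall>x y. f (x + y) = f x + f y) \<and> (\<forall>x y. f (x * y) = f x * f y)"

lemma is_homD:
  assumes "is_hom f"
  shows "f 0 = 0" "f 1 = 1" "f (x + y) = f x + f y" "f (x * y) = f x * f y"
  using assms by (auto simp: is_hom_def)

lemma is_hom_uminus: "is_hom f \<Longrightarrow> f (- x) = - f x"
  using is_homD(1,3)[of f] by (metis add.right_inverse minus_unique)

lemma is_hom_diff: "is_hom f \<Longrightarrow> f (x - y) = f x - f y"
  using is_homD(3)[of f x "- y"] is_hom_uminus[of f y] by simp

lemma is_hom_power: "is_hom f \<Longrightarrow> f (x ^ n) = f x ^ n"
  by (induction n) (auto simp: is_hom_def)

lemma is_hom_sum: "is_hom f \<Longrightarrow> f (\<Sum>i\<in>A. g i) = (\<Sum>i\<in>A. f (g i))"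
  by (induction A rule: infinite_finite_induct) (auto simp: is_hom_def)

lemma is_hom_eq_0_iff:
  fixes f :: "'a::field \<Rightarrow> 'b::field"
  assumes "is_hom f"
  shows "f x = 0 \<longleftrightarrow> x = 0"
proof
  assume "f x = 0"
  show "x = 0"
  proof (rule ccontr)
    assume "x \<noteq> 0"
    then have "f (x * inverse x) = 1"
      using assms by (simp add: is_hom_def)
    then show False
      using \<open>f x = 0\<close> assms by (simp add: is_hom_def)
  qed
qed (use assms in \<open>simp add: is_hom_def\<close>)

lemma is_hom_eq_iff:
  fixes f :: "'a::field \<Rightarrow> 'b::field"
  assumes "is_hom f"
  shows "f x = f y \<longleftrightarrow> x = y"
  using is_hom_eq_0_iff[OF assms, of "x - y"] by (simp add: is_hom_diff[OF assms])

lemma is_hom_inverse: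
  fixes f :: "'a::field \<Rightarrow> 'b::field"
  assumes "is_hom f"
  shows "f (inverse x) = inverse (f x)"
proof (cases "x = 0")
  case False
  then have "f x * f (inverse x) = 1"
    by (simp flip: is_homD(4)[OF assms] add: is_homD(2)[OF assms])
  then show ?thesis
    by (simp add: inverse_unique)
qed (use assms in \<open>simp add: is_hom_def\<close>)

lemma is_hom_divide:
  fixes f :: "'a::field \<Rightarrow> 'b::field"
  assumes "is_hom f"
  shows "f (x / y) = f x / f y"
  by (simp add: divide_inverse is_homD(4)[OF assms] is_hom_inverse[OF assms])

lemma is_hom_power_int:
  fixes f :: "'a::field \<Rightarrow> 'b::field"
  assumes "is_hom f"
  shows "f (x powi n) = f x powi n"
  by (simp add: power_int_def is_hom_power[OF assms] is_hom_inverse[OF assms])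

lemma is_hom_map_poly_add: "is_hom f \<Longrightarrow> map_poly f (p + q) = map_poly f p + map_poly f q"
  by (intro poly_eqI) (simp add: coeff_map_poly is_hom_def)

lemma is_hom_map_poly_mult: "is_hom f \<Longrightarrow> map_poly f (p * q) = map_poly f p * map_poly f q"
  by (intro poly_eqI) (simp add: coeff_map_poly is_hom_def coeff_mult is_hom_sum[of f])

lemma is_hom_map_poly: "is_hom f \<Longrightarrow> is_hom (map_poly f)"
  by (simp add: is_hom_def is_hom_map_poly_add is_hom_map_poly_mult map_poly_1)

lemma is_hom_map_pCons: "is_hom f \<Longrightarrow> map_poly f (pCons a p) = pCons (f a) (map_poly f p)"
  by (intro poly_eqI) (simp add: coeff_map_poly is_hom_def coeff_pCons split: nat.splits)

lemma is_hom_map_monom: "is_hom f \<Longrightarrow> map_poly f (monom a n) = monom (f a) n"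
  by (intro poly_eqI) (simp add: coeff_map_poly is_hom_def)

lemma is_hom_map_smult: "is_hom f \<Longrightarrow> map_poly f (smult a p) = smult (f a) (map_poly f p)"
  by (intro poly_eqI) (simp add: coeff_map_poly is_hom_def)

lemma is_hom_map_pderiv:
  assumes "is_hom f"
  shows "map_poly f (pderiv p) = pderiv (map_poly f p)"
proof -
  have "f (of_nat n) = of_nat n" for n
    by (induction n) (simp_all add: is_homD[OF assms])
  then show ?thesis
    by (intro poly_eqI) (simp add: coeff_map_poly is_homD[OF assms] coeff_pderiv del: of_nat_Suc)
qed

lemma is_hom_map_map: "is_hom f \<Longrightarrow> is_hom g \<Longrightarrow> map_poly f (map_poly g p) = map_poly (\<lambda>x. f (g x)) p"
  by (intro poly_eqI) (simp add: coeff_map_poly is_hom_def)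

lemma is_hom_poly:
  assumes "is_hom f"
  shows "f (poly p a) = poly (map_poly f p) (f a)"
  by (induction p) (simp_all add: is_homD[OF assms] is_hom_map_pCons[OF assms])

lemma is_hom_comp: "is_hom f \<Longrightarrow> is_hom g \<Longrightarrow> is_hom (\<lambda>x. f (g x))"
  by (simp add: is_hom_def)

lemma is_hom_eval: "is_hom (\<lambda>p. poly p a)"
  by (simp add: is_hom_def)

lemma is_hom_eval_map: "is_hom f \<Longrightarrow> is_hom (\<lambda>p. poly (map_poly f p) a)"
  by (rule is_hom_comp[OF is_hom_eval is_hom_map_poly])

lemma is_hom_to_fract: "is_hom to_fract"
  by (simp add: is_hom_def)

lemma is_hom_const: "is_hom (\<lambda>c. [:c:])"
  by (simp add: is_hom_def flip: one_pCons)

lemma is_hom_to_ac: "is_hom to_ac"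
  by (simp add: is_hom_def)

lemma is_hom_constK: "is_hom constK"
  unfolding constK_def
  by (rule is_hom_comp[OF is_hom_to_ac is_hom_comp[OF is_hom_to_fract is_hom_comp[OF is_hom_const is_hom_const]]])

lemma is_hom_laurent:
  fixes f :: "'a::field \<Rightarrow> 'b::field"
  assumes "is_hom f" "\<And>c. f (emb c) = emb' c"
  shows "f (laurent_eval emb S w u v) = laurent_eval emb' S w (f u) (f v)"
  by (simp add: laurent_eval_def is_hom_sum[OF assms(1)] is_homD[OF assms(1)]
    is_hom_power_int[OF assms(1)] assms(2))

text \<open>
  The extension of \<open>g\<close> to fractions is a homomorphism only if \<open>g\<close> vanishes nowhere but at \<open>0\<close>;
  otherwise \<open>0\<close>-denominators yield the junk value \<open>0\<close>.
\<close>

definition lift :: "('a::{idom_divide,ring_gcd,semiring_gcd_mult_normalize} \<Rightarrow> 'b::field) \<Rightarrow> 'a fract \<Rightarrow> 'b" where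
  "lift g r = g (fst (quot_of_fract r)) / g (snd (quot_of_fract r))"

lemma to_fract_quot: "to_fract (fst (quot_of_fract r)) / to_fract (snd (quot_of_fract r)) = r"
  by (metis Fract_conv_to_fract Fract_quot_of_fract)

text \<open>Cross-multiplying with the normalised representation gives an identity between ring
  elements, to which \<open>g\<close> applies; hence any representation computes
  \<open>lift\<close>.\<close>

lemma lift_divide:
  assumes "is_hom g" "\<And>p. p \<noteq> 0 \<Longrightarrow> g p \<noteq> 0" "q \<noteq> 0"
  shows "lift g (to_fract p / to_fract q) = g p / g q"
proof -
  let ?r = "to_fract p / to_fract q"
  let ?a = "fst (quot_of_fract ?r)" and ?b = "snd (quot_of_fract ?r)"
  have b: "?b \<noteq> 0" by simp
  have "to_fract ?a / to_fract ?b = to_fract p / to_fract q"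
    by (rule to_fract_quot)
  then have "to_fract (?a * q) = to_fract (p * ?b)"
    using assms(3) b by (simp add: frac_eq_eq)
  then have "g (?a * q) = g (p * ?b)"
    by (simp only: to_fract_eq_iff)
  then have "g ?a * g q = g p * g ?b"
    by (simp only: is_homD(4)[OF assms(1)])
  then show ?thesis
    using assms(2)[OF assms(3)] assms(2)[OF b] by (simp add: lift_def frac_eq_eq)
qed

lemma lift_to_fract:
  assumes "is_hom g" "\<And>p. p \<noteq> 0 \<Longrightarrow> g p \<noteq> 0"
  shows "lift g (to_fract p) = g p"
  using lift_divide[OF assms, of 1 p] by (simp add: is_homD[OF assms(1)])

lemma is_hom_lift:
  assumes g: "is_hom g" "\<And>p. p \<noteq> 0 \<Longrightarrow> g p \<noteq> 0"
  shows "is_hom (lift g)"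
  unfolding is_hom_def
proof (intro conjI allI)
  show "lift g 0 = 0" "lift g 1 = 1"
    using lift_to_fract[OF g, of 0] lift_to_fract[OF g, of 1] by (simp_all add: is_homD[OF g(1)])
  fix r s :: "'a fract"
  obtain a b where r: "r = to_fract a / to_fract b" "b \<noteq> 0"
    by (metis to_fract_quot snd_quot_of_fract_nonzero)
  obtain c d where s: "s = to_fract c / to_fract d" "d \<noteq> 0"
    by (metis to_fract_quot snd_quot_of_fract_nonzero)
  have nz: "g b \<noteq> 0" "g d \<noteq> 0" using g r s by auto
  have "r + s = to_fract (a * d + c * b) / to_fract (b * d)"
    using r s by (simp add: field_simps)
  moreover have "b * d \<noteq> 0"
    using r(2) s(2) by simp
  ultimately have "lift g (r + s) = g (a * d + c * b) / g (b * d)"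
    using lift_divide[OF g] by metis
  also have "\<dots> = g a / g b + g c / g d"
    using nz by (simp add: is_homD[OF g(1)] field_simps)
  finally show "lift g (r + s) = lift g r + lift g s"
    using r s lift_divide[OF g] by simp
  have "r * s = to_fract (a * c) / to_fract (b * d)"
    using r s by (simp add: field_simps)
  moreover have "b * d \<noteq> 0"
    using r(2) s(2) by simp
  ultimately have "lift g (r * s) = g (a * c) / g (b * d)"
    using lift_divide[OF g] by metis
  then show "lift g (r * s) = lift g r * lift g s"
    using r s lift_divide[OF g] by (simp add: is_homD[OF g(1)])
qed

text \<open>A zero denominator yields 0 on both sides, so junk values commute with \<open>f\<close>
  as well.\<close>

lemma is_hom_lift_comp:
  fixes f :: "'a::field \<Rightarrow> 'b::field"
  assumes "is_hom f"
  shows "f (lift g r) = lift (\<lambda>p. f (g p)) r"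
  by (simp add: lift_def is_hom_divide[OF assms])

text \<open>The coefficient embedding is a parameter so that one function covers evaluation in
  \<open>K\<close> and substitution into polynomials or rational functions.\<close>

definition ev2 :: "('c::comm_ring_1 \<Rightarrow> 'a::comm_ring_1) \<Rightarrow> 'a \<Rightarrow> 'a \<Rightarrow> 'c poly poly \<Rightarrow> 'a" where
  "ev2 emb a b P = poly (map_poly (\<lambda>R. poly (map_poly emb R) a) P) b"

lemma is_hom_ev2: "is_hom emb \<Longrightarrow> is_hom (ev2 emb a b)"
  unfolding ev2_def by (intro is_hom_eval_map)

lemma ev2_hom:
  assumes "is_hom f" "is_hom emb"
  shows "f (ev2 emb a b P) = ev2 (\<lambda>c. f (emb c)) (f a) (f b) P"
  by (simp add: ev2_def is_hom_poly[OF assms(1)] is_hom_map_map assms is_hom_eval_map)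

lemma ev2_const: "is_hom emb \<Longrightarrow> ev2 emb a b [:R:] = poly (map_poly emb R) a"
  by (simp add: ev2_def is_hom_map_pCons is_hom_eval_map)

lemma ev2_const_const: "is_hom emb \<Longrightarrow> ev2 emb a b [:[:c:]:] = emb c"
  by (simp add: ev2_const is_hom_map_pCons)

lemma ev2_X: "is_hom emb \<Longrightarrow> ev2 emb a b [:[:0, 1:]:] = a"
  by (simp add: ev2_const is_hom_map_pCons is_hom_def)

lemma ev2_Y: "is_hom emb \<Longrightarrow> ev2 emb a b [:0, 1:] = b"
  by (simp add: ev2_def is_hom_map_pCons is_hom_eval_map) (simp add: is_hom_def)

lemma ev2_monom: "is_hom emb \<Longrightarrow> ev2 emb a b (monom (monom c m) n) = emb c * a ^ m * b ^ n"
  by (simp add: ev2_def is_hom_map_monom is_hom_eval_map poly_monom)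

text \<open>Algebraic independence over C, that is, genericity of the point (a, b): the condition
  under which evaluation at it extends to a field homomorphism on rational functions.\<close>

definition indep :: "K \<Rightarrow> K \<Rightarrow> bool" where
  "indep a b \<longleftrightarrow> (\<forall>P. P \<noteq> 0 \<longrightarrow> ev2 constK a b P \<noteq> 0)"

section \<open>Subfields and algebraic elements\<close>

definition is_subfield :: "'a::field set \<Rightarrow> bool" where
  "is_subfield F \<longleftrightarrow> 1 \<in> F \<and> (\<forall>a\<in>F. - a \<in> F \<and> inverse a \<in> F) \<and> (\<forall>a\<in>F. \<forall>b\<in>F. a + b \<in> F \<and> a * b \<in> F)"

lemma is_subfieldD:
  assumes "is_subfield F"
  shows "1 \<in> F" "0 \<in> F" "a \<in> F \<Longrightarrow> - a \<in> F" "a \<in> F \<Longrightarrow> inverse a \<in> F"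
    "a \<in> F \<Longrightarrow> b \<in> F \<Longrightarrow> a + b \<in> F" "a \<in> F \<Longrightarrow> b \<in> F \<Longrightarrow> a * b \<in> F"
  using assms unfolding is_subfield_def by (blast, metis add.right_inverse, blast+)

lemma is_subfield_power: "is_subfield F \<Longrightarrow> a \<in> F \<Longrightarrow> a ^ n \<in> F"
  by (induction n) (auto intro: is_subfieldD)

lemma is_subfield_power_int: "is_subfield F \<Longrightarrow> a \<in> F \<Longrightarrow> a powi n \<in> F"
  by (auto simp: power_int_def intro: is_subfield_power is_subfieldD)

lemma is_subfield_sum: "is_subfield F \<Longrightarrow> (\<And>i. i \<in> A \<Longrightarrow> f i \<in> F) \<Longrightarrow> sum f A \<in> F"
  by (induction A rule: infinite_finite_induct) (auto intro: is_subfieldD)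

lemma is_subfield_divide: "is_subfield F \<Longrightarrow> a \<in> F \<Longrightarrow> b \<in> F \<Longrightarrow> a / b \<in> F"
  by (simp add: divide_inverse is_subfieldD)

lemma is_subfield_poly:
  assumes "is_subfield F" "a \<in> F" "\<And>i. Polynomial.coeff p i \<in> F"
  shows "poly p a \<in> F"
  unfolding poly_altdef using assms by (intro is_subfield_sum is_subfieldD is_subfield_power)

lemma is_subfield_laurent:
  assumes "is_subfield F" "u \<in> F" "v \<in> F" "\<And>c. emb c \<in> F"
  shows "laurent_eval emb S w u v \<in> F"
  unfolding laurent_eval_def using assms
  by (intro is_subfield_sum is_subfieldD is_subfield_power_int)

lemma is_subfield_range:
  fixes f :: "'a::field \<Rightarrow> 'b::field"
  assumes "is_hom f"
  shows "is_subfield (range f)"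
  unfolding is_subfield_def
  by (auto simp flip: is_homD[OF assms] is_hom_uminus[OF assms] is_hom_inverse[OF assms])

section \<open>Translation between fields as types and the fields of HOL-Algebra\<close>

lemma ring_of_type_algebra_simps [simp]:
  "carrier ring_of_type_algebra = UNIV"
  "\<one>\<^bsub>ring_of_type_algebra\<^esub> = (1::'a::field)" "\<zero>\<^bsub>ring_of_type_algebra\<^esub> = (0::'a)"
  "a \<oplus>\<^bsub>ring_of_type_algebra\<^esub> b = a + (b::'a)" "a \<otimes>\<^bsub>ring_of_type_algebra\<^esub> b = a * (b::'a)"
  by (simp_all add: ring_of_type_algebra_def)

lemma a_inv_type: "\<ominus>\<^bsub>ring_of_type_algebra\<^esub> a = - (a::'a::field)"
proof -
  interpret type_field: Ring.field "ring_of_type_algebra :: 'a ring"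
    by (rule field_from_type_algebra)
  have "a + \<ominus>\<^bsub>ring_of_type_algebra\<^esub> a = 0"
    using type_field.r_neg[of a] by simp
  then show ?thesis
    by (metis add.inverse_unique)
qed

lemma m_inv_type:
  assumes "a \<noteq> (0::'a::field)"
  shows "inv\<^bsub>ring_of_type_algebra\<^esub> a = inverse a"
proof -
  interpret type_field: Ring.field "ring_of_type_algebra :: 'a ring"
    by (rule field_from_type_algebra)
  show ?thesis
    by (rule type_field.comm_inv_char) (use assms in auto)
qed

lemma is_subfield_subfield_gen: "is_subfield (subfield_gen A)"
proof -
  have inv0: "inverse a \<in> subfield_gen A" if a: "a \<in> subfield_gen A" for a
  proof (cases "a = 0")
    case False
    then show ?thesis
      using generate_field.m_inv[of a "ring_of_type_algebra" A] a
      by (simp add: subfield_gen_def m_inv_type)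
  qed (use a in simp)
  show ?thesis
    using generate_field.one[of "ring_of_type_algebra" A] inv0
      generate_field.a_inv[of _ "ring_of_type_algebra" A]
      generate_field.eng_add[of _ "ring_of_type_algebra" A]
      generate_field.eng_mult[of _ "ring_of_type_algebra" A]
    unfolding is_subfield_def by (simp add: subfield_gen_def a_inv_type)
qed

lemma subfield_gen_incl: "A \<subseteq> subfield_gen A"
  unfolding subfield_gen_def by (auto intro: generate_field.incl)

lemma subfield_gen_min:
  assumes "is_subfield F" "A \<subseteq> F"
  shows "subfield_gen A \<subseteq> F"
proof
  fix a
  assume "a \<in> subfield_gen A"
  then have "a \<in> generate_field ring_of_type_algebra A"
    by (simp add: subfield_gen_def)
  then show "a \<in> F"
    by induction (use assms in \<open>auto simp: a_inv_type m_inv_type intro: is_subfieldD\<close>)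
qed

definition algebraics :: "'a::field set \<Rightarrow> 'a set" where
  "algebraics F = {a. \<exists>p. p \<noteq> 0 \<and> (\<forall>i. Polynomial.coeff p i \<in> F) \<and> poly p a = 0}"

lemma subfield_ring_of_type:
  fixes F :: "'a::field set"
  assumes "is_subfield F"
  shows "subfield F ring_of_type_algebra"
proof -
  interpret type_field: Ring.field "ring_of_type_algebra :: 'a ring"
    by (rule field_from_type_algebra)
  show ?thesis
  proof (rule type_field.subfieldI'[OF type_field.subringI])
    show "inv\<^bsub>ring_of_type_algebra\<^esub> k \<in> F" if "k \<in> F - {\<zero>\<^bsub>ring_of_type_algebra\<^esub>}" for k
      using that assms by (simp add: m_inv_type is_subfieldD)
  qed (use assms in \<open>auto simp: a_inv_type intro: is_subfieldD\<close>)
qed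

text \<open>HOL-Algebra lists coefficients from the leading one down, \<open>Poly\<close> from the
  constant term up; hence \<open>rev\<close>.\<close>

lemma eval_type: "ring.eval ring_of_type_algebra p a = poly (Poly (rev p)) (a::'a::field)"
proof (induction p)
  interpret type_field: Ring.field "ring_of_type_algebra :: 'a ring"
    by (rule field_from_type_algebra)
  case Nil
  show ?case by simp
next
  interpret type_field: Ring.field "ring_of_type_algebra :: 'a ring"
    by (rule field_from_type_algebra)
  case (Cons c p)
  have "a [^]\<^bsub>ring_of_type_algebra\<^esub> n = a ^ n" for n
    by (induction n) simp_all
  with Cons show ?case
    by (simp add: Poly_append poly_monom)
qed

text \<open>This bridge imports from HOL-Algebra the closure of algebraic elements under the field
  operations.\<close>

lemma type_algebraic_iff:
  fixes a :: "'a::field"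
  assumes "is_subfield F"
  shows "\<not> ring.transcendental ring_of_type_algebra F a \<longleftrightarrow> a \<in> algebraics F"
proof
  interpret type_field: Ring.field "ring_of_type_algebra :: 'a ring"
    by (rule field_from_type_algebra)
  have sr: "subring F ring_of_type_algebra"
    using subfield_ring_of_type[OF assms] by (rule subfieldE)
  assume "\<not> type_field.transcendental F a"
  then obtain p where p: "p \<in> carrier (univ_poly ring_of_type_algebra F)" "p \<noteq> []"
    "type_field.eval p a = 0"
    using type_field.algebraicE[OF sr, of a] by (auto simp: over_def)
  then have hd: "set p \<subseteq> F" "hd p \<noteq> 0"
    by (auto simp: univ_poly_def polynomial_def)
  have "Poly (rev p) \<noteq> 0"
  proof
    assume "Poly (rev p) = 0"
    then obtain n where "rev p = replicate n 0"
      by (auto simp: Poly_eq_0)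
    then have "p = replicate n 0"
      by (metis rev_replicate rev_rev_ident)
    then show False
      using p(2) hd(2) by (cases n) auto
  qed
  moreover have "Polynomial.coeff (Poly (rev p)) i \<in> F" for i
    using hd(1) is_subfieldD(2)[OF assms]
    by (cases "i < length p") (auto simp: nth_default_def rev_nth)
  ultimately show "a \<in> algebraics F"
    using p(3) by (auto simp: algebraics_def eval_type intro!: exI[of _ "Poly (rev p)"])
next
  interpret type_field: Ring.field "ring_of_type_algebra :: 'a ring"
    by (rule field_from_type_algebra)
  assume "a \<in> algebraics F"
  then obtain p where p: "p \<noteq> 0" "\<And>i. Polynomial.coeff p i \<in> F" "poly p a = 0"
    by (auto simp: algebraics_def)
  let ?p = "rev (coeffs p)"
  show "\<not> type_field.transcendental F a"
  proof (rule type_field.algebraicI[unfolded over_def])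
    have "set (coeffs p) \<subseteq> F"
      using p(2) range_coeff[of p] by (metis image_subset_iff subset_insertI subset_trans)
    then show "?p \<in> carrier (univ_poly ring_of_type_algebra F)"
      using p(1) by (auto simp: univ_poly_def polynomial_def hd_rev last_coeffs_eq_coeff_degree)
    show "?p \<noteq> []" using p(1) by simp
    show "type_field.eval ?p a = \<zero>\<^bsub>ring_of_type_algebra\<^esub>"
      using p(3) by (simp add: eval_type)
  qed
qed

lemma is_subfield_algebraics:
  fixes F :: "'a::field set"
  assumes "is_subfield F"
  shows "is_subfield (algebraics F)"
proof -
  interpret type_field: Ring.field "ring_of_type_algebra :: 'a ring"
    by (rule field_from_type_algebra)
  have "subfield (algebraics F) ring_of_type_algebra"
    using type_field.subfield_of_algebraics[OF subfield_ring_of_type[OF assms]]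
    by (simp add: type_algebraic_iff[OF assms] over_def)
  then have sub: "subring (algebraics F) ring_of_type_algebra"
    and inv: "\<And>k. k \<in> algebraics F - {0} \<Longrightarrow> inverse k \<in> algebraics F"
    using type_field.subfield_m_inv(1) by (auto dest: subfieldE simp: m_inv_type[symmetric])
  have "inverse k \<in> algebraics F" if "k \<in> algebraics F" for k
    using inv that by (cases "k = 0") auto
  then show ?thesis
    unfolding is_subfield_def
    using subringE[OF sub] by (simp add: a_inv_type)
qed

lemma subset_algebraics:
  assumes "is_subfield F"
  shows "F \<subseteq> algebraics F"
proof
  fix a assume "a \<in> F"
  then have "\<forall>i. Polynomial.coeff [:- a, 1:] i \<in> F"
    using assms by (auto simp: coeff_pCons is_subfieldD split: nat.splits)
  then show "a \<in> algebraics F"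
    unfolding algebraics_def by (intro CollectI exI[of _ "[:- a, 1:]"]) auto
qed

section \<open>Algebraically independent pairs\<close>

text \<open>\<open>f\<close> embeds C(X) into \<open>K\<close> by X to \<open>u\<close>; being
  injective, it turns \<open>P\<close> into a nonzero polynomial over C(u) with root
  \<open>b\<close>.\<close>

lemma ev2_eq_0_imp_algebraic:
  fixes f :: "complex poly fract \<Rightarrow> K"
  assumes f: "is_hom f" "\<And>R. f (to_fract R) = poly (map_poly constK R) u"
    and P: "P \<noteq> 0" "ev2 constK u b P = 0"
  shows "b \<in> algebraics (range f)"
proof -
  let ?p = "map_poly (\<lambda>R. f (to_fract R)) P"
  have "?p \<noteq> 0"
    using P(1) by (subst map_poly_eq_0_iff)
      (auto simp: is_hom_eq_0_iff[OF f(1)] is_homD[OF f(1)])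
  moreover have "\<forall>i. Polynomial.coeff ?p i \<in> range f"
    by (auto simp: coeff_map_poly is_homD(1)[OF f(1)])
  moreover have "poly ?p b = 0"
    using P(2) by (simp add: ev2_def f(2))
  ultimately show ?thesis
    unfolding algebraics_def by blast
qed

text \<open>The converse clears denominators: a polynomial over C(X) is a nonzero scalar times its
  primitive part, which has coefficients in C[X].\<close>

lemma algebraic_imp_ev2_eq_0:
  fixes f :: "complex poly fract \<Rightarrow> K"
  assumes f: "is_hom f" "\<And>R. f (to_fract R) = poly (map_poly constK R) u"
    and b: "b \<in> algebraics (range f)"
  shows "\<exists>P. P \<noteq> 0 \<and> ev2 constK u b P = 0"
proof -
  obtain p where p: "p \<noteq> 0" "\<And>i. Polynomial.coeff p i \<in> range f" "poly p b = 0"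
    using b by (auto simp: algebraics_def)
  define q where "q = map_poly (inv_into UNIV f) p"
  have inj: "inj f"
    by (auto simp: inj_def is_hom_eq_iff[OF f(1)])
  have "inv_into UNIV f 0 = 0"
    using inj is_homD(1)[OF f(1)] by (metis inv_f_f)
  then have pq: "p = map_poly f q"
    using p(2) by (intro poly_eqI) (simp add: q_def coeff_map_poly is_homD(1)[OF f(1)] f_inv_into_f)
  define P where "P = primitive_part_fract q"
  have q: "q = smult (fract_content q) (fract_poly P)"
    unfolding P_def by (rule content_times_primitive_part_fract[symmetric])
  have q0: "q \<noteq> 0"
    using p(1) pq by auto
  then have nz: "fract_content q \<noteq> 0" "P \<noteq> 0"
    using q by (metis smult_0_left, metis fract_poly_0 smult_0_right)
  have "poly p b = f (fract_content q) * poly (map_poly f (fract_poly P)) b"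
    by (subst pq, subst q) (simp add: is_hom_map_smult[OF f(1)])
  also have "map_poly f (fract_poly P) = map_poly (\<lambda>R. poly (map_poly constK R) u) P"
    by (simp add: is_hom_map_map[OF f(1) is_hom_to_fract] f(2))
  finally have "ev2 constK u b P = 0"
    using p(3) nz(1) by (simp add: ev2_def is_hom_eq_0_iff[OF f(1)])
  with nz(2) show ?thesis by blast
qed

lemma indep_imp_transcendental:
  assumes "indep u b" "R \<noteq> 0"
  shows "poly (map_poly constK R) u \<noteq> 0"
proof -
  have "ev2 constK u b [:R:] \<noteq> 0"
    using assms unfolding indep_def by simp
  then show ?thesis
    by (simp add: ev2_const is_hom_constK)
qed

text \<open>If \<open>v\<close> were algebraic over C(u), so would be \<open>S(u, v)\<close> and its
  inverse \<open>\<tau>\<close>, against the independence of \<open>u\<close> and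
  \<open>\<tau>\<close>.\<close>

lemma indep_fibre:
  assumes "indep u \<tau>" "laurent_eval constK S w u v = inverse \<tau>"
  shows "indep u v"
  unfolding indep_def
proof (intro allI impI notI)
  fix P :: "complex poly poly"
  assume P: "P \<noteq> 0" "ev2 constK u v P = 0"
  \<comment> \<open>The embedding of C(X) with image C(u), available because \<open>u\<close> is
    transcendental.\<close>
  define f where "f = lift (\<lambda>R. poly (map_poly constK R) u)"
  have g: "is_hom (\<lambda>R. poly (map_poly constK R) u)" "\<And>R. R \<noteq> 0 \<Longrightarrow> poly (map_poly constK R) u \<noteq> 0"
    using indep_imp_transcendental[OF assms(1)] is_hom_eval_map[OF is_hom_constK] by auto
  have f: "is_hom f" "\<And>R. f (to_fract R) = poly (map_poly constK R) u"
    unfolding f_def using is_hom_lift[OF g] lift_to_fract[OF g] by auto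
  have F: "is_subfield (range f)"
    by (rule is_subfield_range[OF f(1)])
  note A = is_subfield_algebraics[OF F]
  have "v \<in> algebraics (range f)"
    by (rule ev2_eq_0_imp_algebraic[OF f P])
  moreover have "u \<in> range f"
    using f(2)[of "[:0, 1:]"] by (simp add: is_hom_map_pCons[OF is_hom_constK] is_homD[OF is_hom_constK])
      (metis rangeI)
  moreover have "constK c \<in> range f" for c
    using f(2)[of "[:c:]"] by (simp add: is_hom_map_pCons[OF is_hom_constK]) (metis rangeI)
  ultimately have "laurent_eval constK S w u v \<in> algebraics (range f)"
    using subset_algebraics[OF F] by (intro is_subfield_laurent[OF A]) auto
  then have "inverse (inverse \<tau>) \<in> algebraics (range f)"
    unfolding assms(2) by (rule is_subfieldD(4)[OF A])
  then show False
    using algebraic_imp_ev2_eq_0[OF f] assms(1) unfolding indep_def by auto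
qed

lemma poly_const_X: "poly (map_poly (\<lambda>c. [:[:c:]:]) R) [:[:0, 1:]:] = [:R::'a::comm_ring_1 poly:]"
  by (induction R)
    (simp_all add: is_hom_map_pCons[OF is_hom_comp[OF is_hom_const is_hom_const]])

lemma ev2_X_Y: "ev2 (\<lambda>c. [:[:c:]:]) [:[:0, 1:]:] [:0, 1:] P = P"
  by (simp add: ev2_def poly_const_X flip: pcompose_altdef)

text \<open>Exchanging the two variables of a polynomial is an involution, hence preserves being
  nonzero.\<close>

lemma indep_commute:
  assumes "indep a b"
  shows "indep b a"
  unfolding indep_def
proof (intro allI impI)
  fix P :: "complex poly poly"
  assume P: "P \<noteq> 0"
  let ?cc = "\<lambda>c::complex. [:[:c:]:]" and ?X = "[:[:0, 1:]:]" and ?Y = "[:0, 1:]"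
  have cc: "is_hom ?cc"
    by (rule is_hom_comp[OF is_hom_const is_hom_const])
  note ev = is_hom_ev2[OF is_hom_constK] ev2_const_const[OF is_hom_constK]
    ev2_X[OF is_hom_constK] ev2_Y[OF is_hom_constK]
  define Q where "Q = ev2 ?cc ?Y ?X P"
  have "ev2 constK a b Q = ev2 constK b a P"
    unfolding Q_def by (simp add: ev2_hom[OF ev(1) cc] ev)
  moreover have "ev2 ?cc ?Y ?X Q = P"
    unfolding Q_def ev2_hom[OF is_hom_ev2[OF cc] cc]
    by (simp only: ev2_const_const[OF cc] ev2_X[OF cc] ev2_Y[OF cc] ev2_X_Y)
  then have "Q \<noteq> 0"
    using P is_homD(1)[OF is_hom_ev2[OF cc]] by metis
  ultimately show "ev2 constK b a P \<noteq> 0"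
    using assms unfolding indep_def by metis
qed

text \<open>A relation for \<open>inverse b\<close> becomes one for \<open>b\<close> on reversing
  the coefficients.\<close>

lemma indep_inverse:
  assumes "indep a b"
  shows "indep a (inverse b)"
  unfolding indep_def
proof (intro allI impI)
  fix P :: "complex poly poly"
  assume P: "P \<noteq> 0"
  have b: "b \<noteq> 0"
    using assms ev2_Y[OF is_hom_constK] unfolding indep_def by (metis pCons_eq_0_iff zero_neq_one)
  let ?g = "\<lambda>R. poly (map_poly constK R) a"
  have g: "is_hom ?g"
    by (rule is_hom_eval_map[OF is_hom_constK])
  have g0: "?g R = 0 \<longleftrightarrow> R = 0" for R
    using indep_imp_transcendental[OF assms] by (auto simp: is_homD[OF g])
  \<comment> \<open>Reversal depends on the degree, so evaluating the coefficients at
    \<open>a\<close> must not lower it.\<close>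
  have deg: "Polynomial.degree (map_poly ?g p) = Polynomial.degree p" for p
    by (cases "p = 0") (simp_all add: g0 map_poly_degree_eq)
  have "reflect_poly (map_poly ?g P) = map_poly ?g (reflect_poly P)"
    by (intro poly_eqI) (simp add: coeff_map_poly coeff_reflect_poly is_homD(1)[OF g] deg)
  then have "ev2 constK a b (reflect_poly P) =
      b ^ Polynomial.degree (map_poly ?g P) * ev2 constK a (inverse b) P"
    using poly_reflect_poly_nz[OF b, of "map_poly ?g P"] by (simp add: ev2_def)
  moreover have "reflect_poly P \<noteq> 0"
    using P by simp
  ultimately show "ev2 constK a (inverse b) P \<noteq> 0"
    using assms unfolding indep_def by auto
qed

section \<open>The coordinates of the orbit\<close>

lemma is_hom_ev_inner: "is_hom (\<lambda>R. poly (map_poly constK R) u)"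
  by (rule is_hom_eval_map[OF is_hom_constK])

lemma is_hom_poly_sum:
  assumes "is_hom f"
  shows "poly (map_poly f p) a = (\<Sum>i\<le>Polynomial.degree p. f (Polynomial.coeff p i) * a ^ i)"
proof -
  have "poly (map_poly f p) a = poly (map_poly f (\<Sum>i\<le>Polynomial.degree p. Polynomial.monom (Polynomial.coeff p i) i)) a"
    by (simp add: poly_as_sum_of_monoms)
  then show ?thesis
    by (simp add: is_hom_sum[OF is_hom_eval_map[OF assms]] is_hom_map_monom[OF assms] poly_monom)
qed

lemma indep_nonzero:
  assumes "indep a b"
  shows "a \<noteq> 0" "b \<noteq> 0"
  using assms ev2_X[OF is_hom_constK, of a b] ev2_Y[OF is_hom_constK, of a b]
  unfolding indep_def by (metis pCons_eq_0_iff zero_neq_one)+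

text \<open>\<open>step_num / step_den\<close> is S(X, Y) with negative exponents cleared; the
  kernel polynomial is \<open>step_den\<close> minus t times \<open>step_num\<close>.\<close>

definition step_num :: "(int \<times> int) set \<Rightarrow> (int \<times> int \<Rightarrow> complex) \<Rightarrow> complex poly poly" where
  "step_num S w = (\<Sum>s\<in>S. Polynomial.monom (Polynomial.monom (w s) (nat (fst s + shift_x S))) (nat (snd s + shift_y S)))"

definition step_den :: "(int \<times> int) set \<Rightarrow> complex poly poly" where
  "step_den S = Polynomial.monom (Polynomial.monom 1 (nat (shift_x S))) (nat (shift_y S))"

lemma shift_nonneg:
  assumes "finite S" "s \<in> S"
  shows "fst s + shift_x S \<ge> 0" "snd s + shift_y S \<ge> 0"
proof -
  have "Min (fst ` S) \<le> fst s" "Min (snd ` S) \<le> snd s"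
    using assms by auto
  then show "fst s + shift_x S \<ge> 0" "snd s + shift_y S \<ge> 0"
    by (auto simp: shift_x_def shift_y_def)
qed

lemma ev2_step_den:
  "ev2 constK u v (step_den S) = u ^ nat (shift_x S) * v ^ nat (shift_y S)"
  by (simp add: step_den_def ev2_monom[OF is_hom_constK] is_homD[OF is_hom_constK])

lemma ev2_step_num:
  assumes "finite S" "u \<noteq> 0" "v \<noteq> 0"
  shows "ev2 constK u v (step_num S w) = ev2 constK u v (step_den S) * laurent_eval constK S w u v"
  unfolding step_num_def laurent_eval_def ev2_step_den is_hom_sum[OF is_hom_ev2[OF is_hom_constK]]
    ev2_monom[OF is_hom_constK] sum_distrib_left
proof (rule sum.cong)
  fix s assume s: "s \<in> S"
  have pow: "a ^ nat i = a powi i" if "i \<ge> 0" for a :: K and i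
    using that by (simp add: power_int_def)
  have "shift_x S \<ge> 0" "shift_y S \<ge> 0"
    by (simp_all add: shift_x_def shift_y_def)
  then show "constK (w s) * u ^ nat (fst s + shift_x S) * v ^ nat (snd s + shift_y S) =
      u ^ nat (shift_x S) * v ^ nat (shift_y S) * (constK (w s) * u powi fst s * v powi snd s)"
    using assms(2,3) shift_nonneg[OF assms(1) s] by (simp add: pow power_int_add mult_ac)
qed simp

text \<open>A step with nonzero second coordinate contributes to a power of Y other than the only
  one in \<open>step_den\<close>, and its coefficient, a nonzero polynomial in X, does not vanish at
  the transcendental \<open>u\<close>.\<close>

lemma step_fibre_nonconst:
  assumes "finite S" "\<forall>s\<in>S. w s \<noteq> 0" "\<exists>s\<in>S. snd s \<noteq> 0"
    and u: "\<And>R. R \<noteq> 0 \<Longrightarrow> poly (map_poly constK R) u \<noteq> 0"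
  shows "map_poly (\<lambda>R. poly (map_poly constK R) u) (step_num S w) \<noteq>
    smult \<sigma> (map_poly (\<lambda>R. poly (map_poly constK R) u) (step_den S))" (is "map_poly ?g _ \<noteq> _")
proof
  assume eq: "map_poly ?g (step_num S w) = smult \<sigma> (map_poly ?g (step_den S))"
  obtain s where s: "s \<in> S" "snd s \<noteq> 0"
    using assms(3) by blast
  let ?j = "nat (fst s + shift_x S)" and ?k = "nat (snd s + shift_y S)"
  have shift: "shift_x S \<ge> 0" "shift_y S \<ge> 0"
    by (simp_all add: shift_x_def shift_y_def)
  have g: "is_hom ?g"
    by (rule is_hom_ev_inner)
  \<comment> \<open>Distinct steps shift to distinct monomials, so no cancellation can
    occur.\<close>
  have "Polynomial.coeff (Polynomial.coeff (step_num S w) ?k) ?j = (\<Sum>s'\<in>S. if s' = s then w s' else 0)"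
    unfolding step_num_def coeff_sum
  proof (rule sum.cong)
    fix s' assume s': "s' \<in> S"
    have "nat (snd s' + shift_y S) = ?k \<and> nat (fst s' + shift_x S) = ?j \<longleftrightarrow> s' = s"
      using shift_nonneg[OF assms(1) s(1)] shift_nonneg[OF assms(1) s'] by (auto simp: prod_eq_iff)
    then show "Polynomial.coeff (Polynomial.coeff (Polynomial.monom (Polynomial.monom (w s')
        (nat (fst s' + shift_x S))) (nat (snd s' + shift_y S))) ?k) ?j = (if s' = s then w s' else 0)"
      by (auto simp: if_distrib[of "\<lambda>p. Polynomial.coeff p _"])
  qed simp
  then have "Polynomial.coeff (step_num S w) ?k \<noteq> 0"
    using s(1) assms(1,2) by auto
  then have "?g (Polynomial.coeff (step_num S w) ?k) \<noteq> 0"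
    by (rule u)
  moreover have "?k \<noteq> nat (shift_y S)"
    using s shift shift_nonneg[OF assms(1) s(1)] by auto
  then have "Polynomial.coeff (step_den S) ?k = 0"
    by (simp add: step_den_def)
  moreover have "?g (Polynomial.coeff (step_num S w) ?k) = \<sigma> * ?g (Polynomial.coeff (step_den S) ?k)"
    using arg_cong[OF eq, of "\<lambda>p. Polynomial.coeff p ?k"] by (simp add: coeff_map_poly is_homD(1)[OF g])
  ultimately show False
    by simp
qed

text \<open>
  If \<open>B(u, S(u, v)) = 0\<close>, then, \<open>v\<close> being transcendental over \<open>\<complex>(u)\<close>, also \<open>B(u, S(u, v')) = 0\<close> for
  all \<open>v' \<noteq> 0\<close>, so that \<open>S(u, v')\<close> takes only finitely many values and is constant in \<open>v'\<close>.
\<close>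

lemma indep_step:
  assumes S: "finite S" "\<forall>s\<in>S. w s \<noteq> 0" "\<exists>s\<in>S. snd s \<noteq> 0" and ind: "indep u v"
  shows "indep u (laurent_eval constK S w u v)"
  unfolding indep_def
proof (intro allI impI notI)
  fix B :: "complex poly poly"
  assume B: "B \<noteq> 0" "ev2 constK u (laurent_eval constK S w u v) B = 0"
  let ?g = "\<lambda>R. poly (map_poly constK R) u" and ?d = "Polynomial.degree B"
  let ?N = "step_num S w" and ?M = "step_den S"
  note g = is_hom_ev_inner[of u]
  note u = indep_imp_transcendental[OF ind]
  note ev = is_homD[OF is_hom_ev2[OF is_hom_constK]] is_hom_power[OF is_hom_ev2[OF is_hom_constK]]
    is_hom_sum[OF is_hom_ev2[OF is_hom_constK]] ev2_const[OF is_hom_constK]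
  \<comment> \<open>\<open>B(X, N / M)\<close> multiplied by \<open>M ^ degree B\<close> to make it
    a polynomial in X and Y.\<close>
  define P where "P = (\<Sum>i\<le>?d. [:Polynomial.coeff B i:] * ?N ^ i * ?M ^ (?d - i))"
  have P: "ev2 constK u v' P = ev2 constK u v' ?M ^ ?d * ev2 constK u (laurent_eval constK S w u v') B"
    if "v' \<noteq> 0" for v'
  proof -
    have "ev2 constK u v' P = (\<Sum>i\<le>?d. ?g (Polynomial.coeff B i) *
        (ev2 constK u v' ?M * laurent_eval constK S w u v') ^ i * ev2 constK u v' ?M ^ (?d - i))"
      unfolding P_def ev ev2_step_num[OF S(1) indep_nonzero(1)[OF ind] that] ..
    also have "\<dots> = (\<Sum>i\<le>?d. ev2 constK u v' ?M ^ ?d * (?g (Polynomial.coeff B i) * laurent_eval constK S w u v' ^ i))"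
      by (intro sum.cong) (auto simp: power_mult_distrib mult_ac simp flip: power_add)
    finally show ?thesis
      by (simp add: ev2_def is_hom_poly_sum[OF g] sum_distrib_left)
  qed
  have "ev2 constK u v P = 0"
    using P[OF indep_nonzero(2)[OF ind]] B(2) by simp
  then have "P = 0"
    using ind unfolding indep_def by auto
  define b where "b = map_poly ?g B"
  have "b \<noteq> 0"
    using B(1) unfolding b_def by (subst map_poly_eq_0_iff) (use u is_homD(1)[OF g] in auto)
  define q where "q \<sigma> = map_poly ?g ?N - smult \<sigma> (map_poly ?g ?M)" for \<sigma>
  \<comment> \<open>The finitely many roots of \<open>b\<close> bound the values of S(u, v'), and
    each value is taken at finitely many v'; so \<open>K\<close> would be finite.\<close>
  have "UNIV - {0} \<subseteq> (\<Union>\<sigma>\<in>{\<sigma>. poly b \<sigma> = 0}. {v'. poly (q \<sigma>) v' = 0})"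
  proof
    fix v' :: K assume "v' \<in> UNIV - {0}"
    then have v': "v' \<noteq> 0" by simp
    let ?\<sigma> = "laurent_eval constK S w u v'"
    have "ev2 constK u v' ?M \<noteq> 0"
      using v' indep_nonzero(1)[OF ind] by (simp add: ev2_step_den)
    then have "ev2 constK u ?\<sigma> B = 0"
      using P[OF v'] \<open>P = 0\<close> by (simp add: ev(1))
    then have "poly b ?\<sigma> = 0"
      by (simp add: b_def ev2_def)
    moreover have "poly (q ?\<sigma>) v' = 0"
      using ev2_step_num[OF S(1) indep_nonzero(1)[OF ind] v'] by (simp add: q_def ev2_def)
    ultimately show "v' \<in> (\<Union>\<sigma>\<in>{\<sigma>. poly b \<sigma> = 0}. {v'. poly (q \<sigma>) v' = 0})"
      by blast
  qed
  moreover have "q \<sigma> \<noteq> 0" for \<sigma>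
    using step_fibre_nonconst[OF S u] by (simp add: q_def)
  then have "finite (\<Union>\<sigma>\<in>{\<sigma>. poly b \<sigma> = 0}. {v'. poly (q \<sigma>) v' = 0})"
    using \<open>b \<noteq> 0\<close> by (intro finite_UN_I poly_roots_finite)
  ultimately have "finite (UNIV - {0::K})"
    by (rule finite_subset)
  then have "finite (UNIV :: K set)"
    by simp
  then have "finite (range constK)"
    by (rule finite_subset[OF subset_UNIV])
  moreover have "inj constK"
    by (auto simp: inj_def is_hom_eq_iff[OF is_hom_constK])
  ultimately show False
    using finite_imageD infinite_UNIV_char_0 by blast
qed

text \<open>Evaluation at this point is the canonical embedding of C[x][y] into \<open>K\<close>,
  which is injective.\<close>

lemma indep_xK_yK: "indep xK yK"
proof -
  let ?f = "\<lambda>P. to_ac (to_fract P) :: K"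
  have f: "is_hom ?f"
    by (rule is_hom_comp[OF is_hom_to_ac is_hom_to_fract])
  have "ev2 constK xK yK P = ?f P" for P
    using ev2_hom[OF f is_hom_comp[OF is_hom_const is_hom_const], of "[:[:0, 1:]:]" "[:0, 1:]" P]
    by (simp add: ev2_X_Y xK_def yK_def constK_def[abs_def])
  then show ?thesis
    by (simp add: indep_def)
qed

lemma laurent_eval_swap:
  "laurent_eval emb (prod.swap ` S) (w \<circ> prod.swap) v u = laurent_eval emb S w u v"
  unfolding laurent_eval_def by (subst sum.reindex) (simp_all add: mult_ac)

section \<open>Propagation of genericity along the orbit\<close>

locale walk =
  fixes S :: "(int \<times> int) set" and w :: "int \<times> int \<Rightarrow> complex"
  assumes finite_S: "finite S" and weights: "\<forall>s\<in>S. w s \<noteq> 0" and nonuniv: "not_univariate S"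
begin

abbreviation "z \<equiv> laurent_eval constK S w xK yK"

lemma indep_z:
  assumes "indep u v" "laurent_eval constK S w u v = z"
  shows "indep u z" "indep v z"
proof -
  show "indep u z"
    using indep_step[OF finite_S weights _ assms(1)] nonuniv assms(2) by (simp add: not_univariate_def)
  have "indep v (laurent_eval constK (prod.swap ` S) (w \<circ> prod.swap) v u)"
    using finite_S weights nonuniv indep_commute[OF assms(1)]
    by (intro indep_step) (auto simp: not_univariate_def)
  then show "indep v z"
    using assms(2) by (simp add: laurent_eval_swap)
qed

lemma indep_fibres:
  assumes "laurent_eval constK S w u v = z"
  shows "indep u z \<Longrightarrow> indep u v" "indep v z \<Longrightarrow> indep u v"
proof -
  show "indep u v" if "indep u z"
    using indep_fibre[OF indep_inverse[OF that]] assms by simp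
  show "indep u v" if "indep v z"
    using indep_fibre[OF indep_inverse[OF that], of "prod.swap ` S" "w \<circ> prod.swap" u] assms
    by (simp add: laurent_eval_swap indep_commute)
qed

text \<open>Adjacent points share a coordinate. At a generic point it is independent of
  \<open>z\<close>, and a coordinate independent of \<open>z\<close> makes the other point generic
  too.\<close>

lemma orbit_indep:
  assumes "p \<in> orbit S w"
  shows "laurent_eval constK S w (fst p) (snd p) = z \<and> indep (fst p) (snd p)"
proof -
  have step: "laurent_eval constK S w (fst p) (snd p) = z \<and> indep (fst p) (snd p)"
    if adj: "adjacent S w p q" and q: "laurent_eval constK S w (fst q) (snd q) = z \<and> indep (fst q) (snd q)" for p q
  proof -
    have p: "laurent_eval constK S w (fst p) (snd p) = z"
      using adj q by (simp add: adjacent_def)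
    moreover have "indep (fst p) z \<or> indep (snd p) z"
      using adj q indep_z[of "fst q" "snd q"] by (auto simp: adjacent_def)
    ultimately show ?thesis
      using indep_fibres by blast
  qed
  have "(adjacent S w)\<^sup>+\<^sup>+ p (xK, yK)"
    using assms by (simp add: orbit_def)
  then show ?thesis
    by (induction rule: converse_tranclp_induct) (use step indep_xK_yK in auto)
qed

text \<open>The transitive closure contains the base point because \<open>adjacent\<close> is
  reflexive.\<close>

lemma orbit_xy: "(xK, yK) \<in> orbit S w"
  by (auto simp: orbit_def adjacent_def)

text \<open>The orbit thus consists of entire fibres, so sums along its rows and columns run over
  all solutions of one equation.\<close>

lemma orbit_adj:
  assumes "p \<in> orbit S w" "laurent_eval constK S w (fst q) (snd q) = z" "fst q = fst p \<or> snd q = snd p"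
  shows "q \<in> orbit S w"
proof -
  have "adjacent S w q p"
    using assms orbit_indep[OF assms(1)] by (simp add: adjacent_def)
  then show ?thesis
    using assms(1) by (auto simp: orbit_def intro: tranclp_into_tranclp2)
qed

end

section \<open>Sums of rational functions over fibres\<close>

lemma poly_pderiv_linear_mult:
  "poly (pderiv ([:- a, 1:] * q)) a = poly q (a::'a::idom)"
  unfolding pderiv_mult poly_add poly_mult by (simp add: pderiv_pCons)

text \<open>A root listed twice in the multiset of linear factors would also be a root of the
  derivative, so the multiset is a set.\<close>

lemma simple_roots_factorization:
  fixes p :: "'k::alg_closed_field poly"
  assumes "p \<noteq> 0" "\<And>a. poly p a = 0 \<Longrightarrow> poly (pderiv p) a \<noteq> 0"
  shows "p = smult (Polynomial.lead_coeff p) (\<Prod>x | poly p x = 0. [:- x, 1:])"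
    and "card {x. poly p x = 0} = Polynomial.degree p"
proof -
  obtain A where A: "size A = Polynomial.degree p"
    "p = smult (Polynomial.lead_coeff p) (\<Prod>x\<in>#A. [:- x, 1:])"
    using alg_closed_imp_factorization[OF assms(1)] by blast
  have c: "Polynomial.lead_coeff p \<noteq> 0" using assms(1) by simp
  have "count A x \<le> 1" for x
  proof (rule ccontr)
    assume "\<not> count A x \<le> 1"
    then have "{#x, x#} \<subseteq># A"
      by (simp add: subseteq_mset_def)
    then obtain B where B: "A = {#x, x#} + B"
      by (metis subset_mset.le_iff_add)
    then have "p = [:- x, 1:] * ([:- x, 1:] * smult (Polynomial.lead_coeff p) (\<Prod>x\<in>#B. [:- x, 1:]))"
      by (subst A(2)) simp
    then obtain R where "p = [:- x, 1:] * ([:- x, 1:] * R)" by blast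
    then have "poly p x = 0" "poly (pderiv p) x = 0"
      by (simp, simp only: poly_pderiv_linear_mult poly_mult) simp
    then show False using assms(2) by blast
  qed
  then have mset: "A = mset_set (set_mset A)"
    by (intro multiset_eqI) (metis count_greater_zero_iff count_mset_set(1,3) finite_set_mset
        le_antisym less_one linorder_not_less not_in_iff)
  have roots: "{x. poly p x = 0} = set_mset A"
    using c by (subst A(2)) (auto simp: poly_prod_mset prod_mset_zero_iff)
  have "(\<Prod>x\<in>#A. [:- x, 1:]) = (\<Prod>x\<in>set_mset A. [:- x, 1:])"
    by (subst mset) (simp add: prod_unfold_prod_mset)
  then show "p = smult (Polynomial.lead_coeff p) (\<Prod>x | poly p x = 0. [:- x, 1:])"
    using A(2) roots by simp
  show "card {x. poly p x = 0} = Polynomial.degree p"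
    using A(1) roots mset by (metis size_mset_set)
qed

text \<open>
  Lagrange interpolation of \<open>A p'\<close> at the roots of \<open>p\<close>; the result involves only operations that commute
  with field homomorphisms.
\<close>

lemma sum_over_roots:
  fixes p :: "'k::alg_closed_field poly"
  assumes p: "p \<noteq> 0" "\<And>a. poly p a = 0 \<Longrightarrow> poly (pderiv p) a \<noteq> 0"
    and r: "A * pderiv p = p * q + r" "Polynomial.degree r < Polynomial.degree p"
  shows "(\<Sum>v | poly p v = 0. poly A v) =
    Polynomial.coeff r (Polynomial.degree p - 1) / Polynomial.lead_coeff p"
proof -
  define Z where "Z = {x. poly p x = 0}"
  define c where "c = Polynomial.lead_coeff p"
  define L where "L v = (\<Prod>x\<in>Z - {v}. [:- x, 1:])" for v
  have fin: "finite Z" using p(1) by (simp add: Z_def poly_roots_finite)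
  have c: "c \<noteq> 0" using p(1) by (simp add: c_def)
  have pZ: "p = smult c (\<Prod>x\<in>Z. [:- x, 1:])" and card: "card Z = Polynomial.degree p"
    using simple_roots_factorization[OF p] by (simp_all add: Z_def c_def)
  have degL: "Polynomial.degree (L v) = Polynomial.degree p - 1"
    and lcL: "Polynomial.coeff (L v) (Polynomial.degree p - 1) = 1" if "v \<in> Z" for v
  proof -
    have "Polynomial.degree (L v) = (\<Sum>x\<in>Z - {v}. 1)"
      unfolding L_def by (subst degree_prod_eq_sum_degree) auto
    then show d: "Polynomial.degree (L v) = Polynomial.degree p - 1"
      using that fin card by simp
    have "Polynomial.lead_coeff (L v) = 1"
      unfolding L_def lead_coeff_prod by simp
    then show "Polynomial.coeff (L v) (Polynomial.degree p - 1) = 1"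
      using d by simp
  qed
  have r_val: "poly r v = c * poly A v * poly (L v) v" if v: "v \<in> Z" for v
  proof -
    have "p = [:- v, 1:] * smult c (L v)"
      by (subst pZ) (simp add: L_def prod.remove[OF fin v])
    then have "poly (pderiv p) v = c * poly (L v) v"
      by (simp only: poly_pderiv_linear_mult poly_smult)
    moreover have "poly A v * poly (pderiv p) v = poly r v"
      using arg_cong[OF r(1), of "\<lambda>f. poly f v"] v by (simp add: Z_def)
    ultimately show ?thesis by (simp add: mult_ac)
  qed
  \<comment> \<open>The interpolant at the roots: it takes the value of \<open>r\<close> at each,
    and its coefficient at \<open>degree p - 1\<close> is \<open>c\<close> times the desired
    sum.\<close>
  define E where "E = (\<Sum>v\<in>Z. smult (c * poly A v) (L v))"
  have eq: "poly r v = poly E v" if v: "v \<in> Z" for v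
  proof -
    have "poly (L v') v = 0" if "v' \<in> Z - {v}" for v'
      unfolding L_def poly_prod using that v fin by (intro prod_zero) auto
    then have "poly E v = c * poly A v * poly (L v) v"
      unfolding E_def poly_sum by (subst sum.remove[OF fin v]) simp
    then show ?thesis using r_val[OF v] by simp
  qed
  have "Polynomial.degree E \<le> Polynomial.degree p - 1"
    unfolding E_def using fin degL by (intro degree_sum_le) (auto intro: order.trans[OF degree_smult_le])
  \<comment> \<open>\<open>r(2)\<close> forces \<open>degree p > 0\<close>, so the truncated
    subtraction is harmless.\<close>
  then have "Polynomial.degree E < Polynomial.degree p"
    using r(2) by linarith
  then have "r = E"
    using r(2) unfolding card[symmetric] by - (rule poly_eqI_degree[OF eq])
  then have "Polynomial.coeff r (Polynomial.degree p - 1) = (\<Sum>v\<in>Z. c * poly A v)"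
    using lcL by (simp add: E_def coeff_sum)
  then show ?thesis
    using c by (simp add: c_def Z_def flip: sum_distrib_left)
qed

text \<open>
  \<open>\<psi> (u, v)\<close> evaluates rational functions of \<open>X, Y\<close> and \<open>\<phi> u\<close> those of \<open>X, t\<close>, both fields being
  represented by the same type; \<open>\<iota>\<close> is the inclusion of the second field into the first.
\<close>

locale fibration =
  fixes Orb :: "('k::alg_closed_field \<times> 'k) set" and \<phi> :: "'k \<Rightarrow> 'l::field \<Rightarrow> 'k"
    and \<psi> :: "'k \<times> 'k \<Rightarrow> 'l \<Rightarrow> 'k" and \<iota> :: "'l \<Rightarrow> 'l" and Y :: 'l and Q :: "'l poly"
  assumes hom_\<phi>: "(u, v) \<in> Orb \<Longrightarrow> is_hom (\<phi> u)"
    and hom_\<psi>: "p \<in> Orb \<Longrightarrow> is_hom (\<psi> p)"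
    and \<psi>_\<iota>: "(u, v) \<in> Orb \<Longrightarrow> \<psi> (u, v) (\<iota> a) = \<phi> u a"
    and \<psi>_Y: "(u, v) \<in> Orb \<Longrightarrow> \<psi> (u, v) Y = v"
    and snd_nonzero: "(u, v) \<in> Orb \<Longrightarrow> v \<noteq> 0"
    and Q_nonzero: "Q \<noteq> 0"
    and Q_root: "(u, v) \<in> Orb \<Longrightarrow> poly (map_poly (\<phi> u) Q) v = 0"
    and root_Q: "(u, v) \<in> Orb \<Longrightarrow> poly (map_poly (\<phi> u) Q) v' = 0 \<Longrightarrow> v' \<noteq> 0 \<Longrightarrow> (u, v') \<in> Orb"
    and quotient: "\<exists>N D. \<forall>u v. (u, v) \<in> Orb \<longrightarrow> poly (map_poly (\<phi> u) D) v \<noteq> 0 \<and>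
      \<psi> (u, v) r * poly (map_poly (\<phi> u) D) v = poly (map_poly (\<phi> u) N) v"
    and char_0: "of_nat (Suc n) \<noteq> (0::'l)"
    and nonempty: "Orb \<noteq> {}"
begin

text \<open>The value A(Y), with coefficients moved by \<open>\<iota>\<close>. As
  \<open>\<iota>\<close> is not assumed to be a homomorphism, the rules for \<open>at_Y\<close> are
  derived by evaluating at a point of \<open>Orb\<close>.\<close>

definition at_Y :: "'l poly \<Rightarrow> 'l" where
  "at_Y A = (\<Sum>i\<le>Polynomial.degree A. \<iota> (Polynomial.coeff A i) * Y ^ i)"

lemma eval_at_Y:
  assumes "(u, v) \<in> Orb"
  shows "poly (map_poly (\<phi> u) A) v = \<psi> (u, v) (at_Y A)"
proof -
  note h = hom_\<psi>[OF assms]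
  show ?thesis
    unfolding at_Y_def is_hom_poly_sum[OF hom_\<phi>[OF assms]]
    by (simp add: is_hom_sum[OF h] is_homD(4)[OF h] is_hom_power[OF h] \<psi>_\<iota>[OF assms] \<psi>_Y[OF assms])
qed

text \<open>The right-hand side does not mention the point: a relation holding at one point of
  \<open>Orb\<close> holds at all of them.\<close>

lemma eval_eq_0_iff:
  assumes "(u, v) \<in> Orb"
  shows "poly (map_poly (\<phi> u) A) v = 0 \<longleftrightarrow> at_Y A = 0"
  by (simp add: eval_at_Y[OF assms] is_hom_eq_0_iff[OF hom_\<psi>[OF assms]])

lemma is_hom_eval_fibre: "(u, v) \<in> Orb \<Longrightarrow> is_hom (\<lambda>A. poly (map_poly (\<phi> u) A) v)"
  by (rule is_hom_eval_map[OF hom_\<phi>])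

lemma at_Y_mult_eq_0: "at_Y (A * B) = 0 \<longleftrightarrow> at_Y A = 0 \<or> at_Y B = 0"
proof -
  obtain u v where uv: "(u, v) \<in> Orb" using nonempty by auto
  show ?thesis
    by (simp add: is_homD(4)[OF is_hom_eval_fibre[OF uv]] flip: eval_eq_0_iff[OF uv])
qed

lemma at_Y_add_eq_0: "at_Y A = 0 \<Longrightarrow> at_Y (A + B) = 0 \<longleftrightarrow> at_Y B = 0"
proof -
  obtain u v where uv: "(u, v) \<in> Orb" using nonempty by auto
  show "at_Y A = 0 \<Longrightarrow> at_Y (A + B) = 0 \<longleftrightarrow> at_Y B = 0"
    by (simp add: is_homD(3)[OF is_hom_eval_fibre[OF uv]] flip: eval_eq_0_iff[OF uv])
qed

lemma at_Y_const: "at_Y [:a:] = 0 \<longleftrightarrow> a = 0"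
proof -
  obtain u v where uv: "(u, v) \<in> Orb" using nonempty by auto
  show ?thesis
    by (simp add: is_hom_map_pCons[OF hom_\<phi>[OF uv]] is_hom_eq_0_iff[OF hom_\<phi>[OF uv]]
        flip: eval_eq_0_iff[OF uv])
qed

lemma at_Y_X: "at_Y [:0, 1:] \<noteq> 0"
proof -
  obtain u v where uv: "(u, v) \<in> Orb" using nonempty by auto
  show ?thesis
    by (simp add: is_hom_map_pCons[OF hom_\<phi>[OF uv]] is_homD[OF hom_\<phi>[OF uv]]
        snd_nonzero[OF uv] flip: eval_eq_0_iff[OF uv])
qed

text \<open>The minimal polynomial of \<open>Y\<close> over the second field, up to a scalar. It
  replaces \<open>Q\<close> because minimality rules out multiple roots and the root 0.\<close>

definition min_poly :: "'l poly" where
  "min_poly = arg_min Polynomial.degree (\<lambda>p. p \<noteq> 0 \<and> at_Y p = 0)"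

lemma min_poly: "min_poly \<noteq> 0" "at_Y min_poly = 0"
  and min_poly_le: "p \<noteq> 0 \<Longrightarrow> at_Y p = 0 \<Longrightarrow> Polynomial.degree min_poly \<le> Polynomial.degree p"
proof -
  obtain u v where uv: "(u, v) \<in> Orb" using nonempty by auto
  have "Q \<noteq> 0 \<and> at_Y Q = 0"
    using Q_nonzero Q_root[OF uv] by (simp add: eval_eq_0_iff[OF uv])
  note m = arg_min_nat_lemma[of "\<lambda>p. p \<noteq> 0 \<and> at_Y p = 0", OF this, of Polynomial.degree]
  show "min_poly \<noteq> 0" "at_Y min_poly = 0"
    "p \<noteq> 0 \<Longrightarrow> at_Y p = 0 \<Longrightarrow> Polynomial.degree min_poly \<le> Polynomial.degree p"
    using m unfolding min_poly_def by blast+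
qed

lemma at_Y_small:
  "p \<noteq> 0 \<Longrightarrow> Polynomial.degree p < Polynomial.degree min_poly \<Longrightarrow> at_Y p \<noteq> 0"
  using min_poly_le by force

lemma degree_min_poly: "Polynomial.degree min_poly > 0"
proof (rule ccontr)
  assume "\<not> 0 < Polynomial.degree min_poly"
  then obtain a where "min_poly = [:a:]"
    by (metis degree_eq_zeroE gr0I)
  then show False
    using min_poly at_Y_const by simp
qed

text \<open>Separability: in characteristic 0 the derivative is nonzero of smaller degree, so by
  minimality it cannot vanish at \<open>Y\<close>.\<close>

lemma pderiv_min_poly: "at_Y (pderiv min_poly) \<noteq> 0"
proof (rule at_Y_small)
  let ?n = "Polynomial.degree min_poly - 1"
  have "Polynomial.coeff (pderiv min_poly) ?n = of_nat (Suc ?n) * Polynomial.lead_coeff min_poly"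
    using degree_min_poly by (simp add: coeff_pderiv)
  then have "Polynomial.coeff (pderiv min_poly) ?n \<noteq> 0"
    using min_poly(1) char_0 by (simp del: of_nat_Suc)
  then show "pderiv min_poly \<noteq> 0" by auto
  have "Polynomial.degree (pderiv min_poly) \<le> ?n"
    by (rule degree_le) (auto simp: coeff_pderiv coeff_eq_0)
  then show "Polynomial.degree (pderiv min_poly) < Polynomial.degree min_poly"
    using degree_min_poly by linarith
qed

lemma min_poly_dvd:
  assumes "at_Y A = 0"
  shows "min_poly dvd A"
proof -
  have "at_Y (min_poly * (A div min_poly)) = 0"
    by (simp add: at_Y_mult_eq_0 min_poly)
  then have "at_Y (A mod min_poly) = 0"
    using at_Y_add_eq_0[of "min_poly * (A div min_poly)" "A mod min_poly"] assms by simp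
  moreover have "A mod min_poly \<noteq> 0 \<longrightarrow> Polynomial.degree (A mod min_poly) < Polynomial.degree min_poly"
    using degree_mod_less[OF min_poly(1)] by blast
  ultimately show ?thesis
    using at_Y_small by (auto simp: dvd_eq_mod_eq_0)
qed

text \<open>A factor Y could be cancelled, as \<open>Y\<close> is nonzero, leaving an annihilating
  polynomial of smaller degree.\<close>

lemma poly_0_min_poly: "poly min_poly 0 \<noteq> 0"
proof
  assume "poly min_poly 0 = 0"
  then obtain p where p: "min_poly = [:0, 1:] * p"
    by (auto simp: poly_eq_0_iff_dvd)
  then have "p \<noteq> 0" "at_Y p = 0"
    using min_poly at_Y_mult_eq_0[of "[:0, 1:]" p] at_Y_X by auto
  moreover have "Polynomial.degree min_poly = Suc (Polynomial.degree p)"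
    unfolding p using \<open>p \<noteq> 0\<close> by (subst degree_mult_eq) auto
  ultimately show False
    using at_Y_small by force
qed

text \<open>From left to right, \<open>min_poly\<close> divides \<open>Q\<close>, whose nonzero
  roots stay in \<open>Orb\<close>; from right to left, vanishing does not depend on the
  point.\<close>

lemma root_min_poly_iff:
  assumes "(u, v) \<in> Orb"
  shows "poly (map_poly (\<phi> u) min_poly) v' = 0 \<longleftrightarrow> (u, v') \<in> Orb"
proof
  note h = is_hom_eval_map[OF hom_\<phi>[OF assms]]
  assume z: "poly (map_poly (\<phi> u) min_poly) v' = 0"
  have "at_Y Q = 0"
    using Q_root[OF assms] by (simp add: eval_eq_0_iff[OF assms])
  then obtain q where "Q = min_poly * q"
    using min_poly_dvd by blast
  then have "poly (map_poly (\<phi> u) Q) v' = 0"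
    using z by (simp add: is_homD(4)[OF h])
  moreover have "v' \<noteq> 0"
  proof
    assume "v' = 0"
    then have "\<phi> u (poly min_poly 0) = 0"
      using z by (simp add: is_hom_poly[OF hom_\<phi>[OF assms]] is_homD(1)[OF hom_\<phi>[OF assms]])
    then show False
      using poly_0_min_poly by (simp add: is_hom_eq_0_iff[OF hom_\<phi>[OF assms]])
  qed
  ultimately show "(u, v') \<in> Orb"
    using root_Q[OF assms] by blast
next
  assume "(u, v') \<in> Orb"
  then show "poly (map_poly (\<phi> u) min_poly) v' = 0"
    using min_poly eval_eq_0_iff by blast
qed

text \<open>
  By induction on the degree of \<open>D\<close>: if \<open>min_poly = D q + r\<close>, then \<open>D q\<close> agrees with \<open>- r\<close> at \<open>Y\<close>.
\<close>

lemma inverse_mod_min_poly: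
  assumes "at_Y D \<noteq> 0"
  shows "\<exists>E. at_Y (D * E - 1) = 0"
proof -
  have *: "\<exists>E. at_Y (D * E - 1) = 0" if "at_Y D \<noteq> 0" "Polynomial.degree D < Polynomial.degree min_poly" for D
    using that
  proof (induction "Polynomial.degree D" arbitrary: D rule: less_induct)
    case less
    show ?case
    proof (cases "Polynomial.degree D = 0")
      case True
      then obtain a where a: "D = [:a:]" by (metis degree_eq_zeroE)
      then have "a \<noteq> 0" using less.prems(1) at_Y_const by simp
      then have "D * [:inverse a:] - 1 = [:0:]"
        using a by (simp add: one_pCons)
      then show ?thesis
        using at_Y_const[of 0] by metis
    next
      case False
      define q r where "q = min_poly div D" and "r = min_poly mod D"
      have qr: "min_poly = D * q + r"
        by (simp add: q_def r_def)
      have D0: "D \<noteq> 0" using False by auto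
      have "r = 0 \<or> Polynomial.degree r < Polynomial.degree D"
        unfolding r_def using degree_mod_less[OF D0] by blast
      then have r: "Polynomial.degree r < Polynomial.degree D"
        using False by auto
      have "q \<noteq> 0"
        using qr r less.prems(2) by auto
      then have "Polynomial.degree (D * q) = Polynomial.degree D + Polynomial.degree q"
        using D0 by (simp add: degree_mult_eq)
      moreover have "Polynomial.degree (D * q) = Polynomial.degree min_poly"
        unfolding qr using r calculation by (subst degree_add_eq_left) auto
      ultimately have "at_Y q \<noteq> 0"
        using \<open>q \<noteq> 0\<close> False by (intro at_Y_small) auto
      then have "at_Y (D * q) \<noteq> 0"
        using less.prems by (simp add: at_Y_mult_eq_0)
      then have "at_Y r \<noteq> 0"
        using min_poly(2) at_Y_add_eq_0[of r "D * q"] qr by (auto simp: add.commute)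
      then obtain E where E: "at_Y (r * E - 1) = 0"
        using less.hyps[OF r] r less.prems(2) by auto
      have "at_Y (min_poly * (- E) + (r * E - 1)) = 0"
        using E min_poly(2) at_Y_add_eq_0[of "min_poly * (- E)" "r * E - 1"]
          at_Y_mult_eq_0[of min_poly "- E"] by blast
      also have "min_poly * (- E) + (r * E - 1) = D * (- q * E) - 1"
        unfolding qr by (simp add: algebra_simps)
      finally show ?thesis by blast
    qed
  qed
  \<comment> \<open>The induction covered degrees below that of \<open>min_poly\<close>; the general
    case reduces to the remainder.\<close>
  define r where "r = D mod min_poly"
  have D: "D = min_poly * (D div min_poly) + r"
    by (simp add: r_def)
  have "r = 0 \<or> Polynomial.degree r < Polynomial.degree min_poly"
    unfolding r_def using degree_mod_less[OF min_poly(1)] by blast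
  then have "Polynomial.degree r < Polynomial.degree min_poly"
    using degree_min_poly by auto
  moreover have m: "at_Y (min_poly * A) = 0" for A
    using min_poly(2) by (simp add: at_Y_mult_eq_0)
  then have "at_Y r \<noteq> 0"
    using assms D at_Y_add_eq_0 by metis
  ultimately obtain E where E: "at_Y (r * E - 1) = 0"
    using * by blast
  have "D * E - 1 = min_poly * (D div min_poly * E) + (r * E - 1)"
    by (subst D) (simp add: algebra_simps)
  then have "at_Y (D * E - 1) = 0"
    using E at_Y_add_eq_0[OF m] by metis
  then show ?thesis ..
qed

text \<open>In N/D the inverse of D is replaced by a polynomial inverse modulo
  \<open>min_poly\<close>, the same for every point.\<close>

lemma polynomial_in_Y:
  "\<exists>A. \<forall>u v. (u, v) \<in> Orb \<longrightarrow> \<psi> (u, v) r = poly (map_poly (\<phi> u) A) v"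
proof -
  obtain N D where ND: "\<And>u v. (u, v) \<in> Orb \<Longrightarrow> poly (map_poly (\<phi> u) D) v \<noteq> 0"
    "\<And>u v. (u, v) \<in> Orb \<Longrightarrow> \<psi> (u, v) r * poly (map_poly (\<phi> u) D) v = poly (map_poly (\<phi> u) N) v"
    using quotient[of r] by blast
  obtain u v where uv: "(u, v) \<in> Orb" using nonempty by auto
  have "at_Y D \<noteq> 0"
    using ND(1)[OF uv] by (simp add: eval_eq_0_iff[OF uv])
  then obtain E where E: "at_Y (D * E - 1) = 0"
    using inverse_mod_min_poly by blast
  have "\<psi> (u, v) r = poly (map_poly (\<phi> u) (N * E)) v" if "(u, v) \<in> Orb" for u v
  proof -
    note h = is_hom_eval_fibre[OF that]
    have "poly (map_poly (\<phi> u) D) v * poly (map_poly (\<phi> u) E) v = 1"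
      using E eval_eq_0_iff[OF that, of "D * E - 1"] by (simp add: is_hom_diff[OF h] is_homD[OF h])
    then have "\<psi> (u, v) r = \<psi> (u, v) r * poly (map_poly (\<phi> u) D) v * poly (map_poly (\<phi> u) E) v"
      by (simp add: mult.assoc)
    then show ?thesis
      using ND(2)[OF that] by (simp add: is_homD(4)[OF h])
  qed
  then show ?thesis by blast
qed

text \<open>The polynomial division behind \<open>sum_over_roots\<close> is done once over the
  formal field and then mapped by each \<open>\<phi> u\<close>, so \<open>a\<close> is independent
  of \<open>u\<close>.\<close>

theorem sum_over_fibre:
  "\<exists>a. \<forall>u v. (u, v) \<in> Orb \<longrightarrow> (\<Sum>v' | (u, v') \<in> Orb. \<psi> (u, v') r) = \<phi> u a"
proof -
  obtain A where A: "\<And>u v. (u, v) \<in> Orb \<Longrightarrow> \<psi> (u, v) r = poly (map_poly (\<phi> u) A) v"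
    using polynomial_in_Y[of r] by blast
  let ?p = min_poly
  define q where "q = (A * pderiv ?p) div ?p"
  define s where "s = (A * pderiv ?p) mod ?p"
  have qs: "A * pderiv ?p = ?p * q + s"
    by (simp add: q_def s_def)
  have "s = 0 \<or> Polynomial.degree s < Polynomial.degree ?p"
    unfolding s_def using degree_mod_less[OF min_poly(1)] by blast
  then have s: "Polynomial.degree s < Polynomial.degree ?p"
    using degree_min_poly by auto
  have "(\<Sum>v' | (u, v') \<in> Orb. \<psi> (u, v') r) =
      \<phi> u (Polynomial.coeff s (Polynomial.degree ?p - 1) / Polynomial.lead_coeff ?p)"
    if uv: "(u, v) \<in> Orb" for u v
  proof -
    note h = hom_\<phi>[OF uv]
    let ?P = "map_poly (\<phi> u) ?p"
    have nz: "\<phi> u a \<noteq> 0" if "a \<noteq> 0" for a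
      using that by (simp add: is_hom_eq_0_iff[OF h])
    have deg: "Polynomial.degree ?P = Polynomial.degree ?p"
      by (rule map_poly_degree_eq) (use min_poly(1) nz in auto)
    have roots: "{v'. poly ?P v' = 0} = {v'. (u, v') \<in> Orb}"
      using root_min_poly_iff[OF uv] by blast
    have "(\<Sum>v' | (u, v') \<in> Orb. \<psi> (u, v') r) = (\<Sum>v' | poly ?P v' = 0. poly (map_poly (\<phi> u) A) v')"
      unfolding roots by (intro sum.cong) (auto simp: A)
    also have "\<dots> = Polynomial.coeff (map_poly (\<phi> u) s) (Polynomial.degree ?P - 1) / Polynomial.lead_coeff ?P"
    proof (rule sum_over_roots)
      show "?P \<noteq> 0"
        using deg degree_min_poly by auto
      show "poly (pderiv ?P) a \<noteq> 0" if "poly ?P a = 0" for a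
      proof -
        have "(u, a) \<in> Orb" using that roots by blast
        then show ?thesis
          using pderiv_min_poly eval_eq_0_iff by (simp flip: is_hom_map_pderiv[OF h])
      qed
      show "map_poly (\<phi> u) A * pderiv ?P = ?P * map_poly (\<phi> u) q + map_poly (\<phi> u) s"
        using arg_cong[OF qs, of "map_poly (\<phi> u)"]
        by (simp add: is_hom_map_poly_add[OF h] is_hom_map_poly_mult[OF h] is_hom_map_pderiv[OF h])
      show "Polynomial.degree (map_poly (\<phi> u) s) < Polynomial.degree ?P"
        using s deg map_poly_degree_leq[of "\<phi> u" s] by linarith
    qed
    finally show ?thesis
      by (simp add: deg coeff_map_poly is_homD(1)[OF h] is_hom_divide[OF h])
  qed
  then show ?thesis by blast
qed

end

section \<open>Fibres of the step polynomial\<close>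

type_synonym L = "complex poly poly fract"

abbreviation evL :: "K \<Rightarrow> K \<Rightarrow> L \<Rightarrow> K" where
  "evL a b \<equiv> lift (ev2 constK a b)"

lemma evL_simps:
  assumes "indep a b"
  shows "is_hom (evL a b)" "evL a b (to_fract P) = ev2 constK a b P"
    "Q \<noteq> 0 \<Longrightarrow> evL a b (to_fract P / to_fract Q) = ev2 constK a b P / ev2 constK a b Q"
  using assms unfolding indep_def
  by (simp_all add: is_hom_lift is_hom_ev2 is_hom_constK lift_to_fract lift_divide)

definition constL :: "complex \<Rightarrow> L" where
  "constL c = to_fract [:[:c:]:]"

definition XL :: L where
  "XL = to_fract [:[:0, 1:]:]"

definition YL :: L where
  "YL = to_fract [:0, 1:]"

lemma is_hom_constL: "is_hom constL"
  unfolding constL_def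
  by (rule is_hom_comp[OF is_hom_to_fract is_hom_comp[OF is_hom_const is_hom_const]])

lemma evL_generators:
  assumes "indep a b"
  shows "evL a b (constL c) = constK c" "evL a b XL = a" "evL a b YL = b"
  by (simp_all add: constL_def XL_def YL_def evL_simps[OF assms] ev2_const_const[OF is_hom_constK]
    ev2_X[OF is_hom_constK] ev2_Y[OF is_hom_constK])

lemma evL_ev2:
  assumes "indep a b"
  shows "evL a b (ev2 constL r s P) = ev2 constK (evL a b r) (evL a b s) P"
  by (simp add: ev2_hom[OF evL_simps(1)[OF assms] is_hom_constL] evL_generators[OF assms])

lemma evL_lift_ev2:
  assumes "indep a b"
  shows "evL a b (lift (ev2 constL r s) f) = evL (evL a b r) (evL a b s) f"
  by (simp add: is_hom_lift_comp[OF evL_simps(1)[OF assms]] evL_ev2[OF assms])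

lemma evL_commute:
  assumes "indep a b"
  shows "evL b a (lift (ev2 constL YL XL) r) = evL a b r"
  by (simp add: evL_lift_ev2 evL_generators indep_commute[OF assms])

lemma evL_laurent:
  assumes "indep a b"
  shows "evL a b (laurent_eval constL S w XL YL) = laurent_eval constK S w a b"
  using is_hom_laurent[OF evL_simps(1)[OF assms] evL_generators(1)[OF assms]]
  by (simp add: evL_generators[OF assms])

text \<open>Only rows are treated; the abstract \<open>Orb\<close> allows columns to be obtained
  from the orbit with its coordinates exchanged.\<close>

locale walk_fibres =
  fixes S :: "(int \<times> int) set" and w :: "int \<times> int \<Rightarrow> complex"
    and Orb :: "(K \<times> K) set" and \<sigma> :: K
  assumes S: "finite S" "\<forall>s\<in>S. w s \<noteq> 0" "\<exists>s\<in>S. snd s \<noteq> 0"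
    and Orb_ind: "(u, v) \<in> Orb \<Longrightarrow> indep u v" "(u, v) \<in> Orb \<Longrightarrow> indep u (inverse \<sigma>)"
    and Orb_val: "(u, v) \<in> Orb \<Longrightarrow> laurent_eval constK S w u v = \<sigma>"
    and Orb_fibre: "(u, v) \<in> Orb \<Longrightarrow> laurent_eval constK S w u v' = \<sigma> \<Longrightarrow> (u, v') \<in> Orb"
    and Orb_nonempty: "Orb \<noteq> {}"
begin

text \<open>The inclusion of C(X, t) into C(X, Y) by t = 1/S(X, Y); the second variable of the
  argument plays the role of t.\<close>

definition embed :: "L \<Rightarrow> L" where
  "embed a = lift (ev2 constL XL (inverse (laurent_eval constL S w XL YL))) a"

text \<open>The kernel polynomial as a polynomial in Y over C(X, t). The coefficient
  \<open>YL\<close> stands for t here.\<close>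

definition fibre_poly :: "L poly" where
  "fibre_poly = map_poly (\<lambda>R. to_fract [:R:]) (step_den S) -
    smult YL (map_poly (\<lambda>R. to_fract [:R:]) (step_num S w))"

lemma is_hom_inner: "is_hom (\<lambda>R. to_fract [:R:])"
  by (rule is_hom_comp[OF is_hom_to_fract is_hom_const])

lemma evL_map_inner:
  assumes "indep u b"
  shows "map_poly (evL u b) (map_poly (\<lambda>R. to_fract [:R:]) P) = map_poly (\<lambda>R. poly (map_poly constK R) u) P"
  by (simp add: is_hom_map_map[OF evL_simps(1)[OF assms] is_hom_inner] evL_simps(2)[OF assms]
      ev2_const[OF is_hom_constK])

lemma map_fibre_poly:
  assumes "(u, v) \<in> Orb"
  shows "map_poly (evL u (inverse \<sigma>)) fibre_poly = map_poly (\<lambda>R. poly (map_poly constK R) u) (step_den S) -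
    smult (inverse \<sigma>) (map_poly (\<lambda>R. poly (map_poly constK R) u) (step_num S w))"
proof -
  note ind = Orb_ind(2)[OF assms]
  show ?thesis
    unfolding fibre_poly_def
    by (simp add: is_hom_diff[OF is_hom_map_poly[OF evL_simps(1)[OF ind]]]
        is_hom_map_smult[OF evL_simps(1)[OF ind]] evL_map_inner[OF ind] evL_generators[OF ind])
qed

lemma fibre_poly_root_iff:
  assumes "(u, v) \<in> Orb" "v' \<noteq> 0"
  shows "poly (map_poly (evL u (inverse \<sigma>)) fibre_poly) v' = 0 \<longleftrightarrow> laurent_eval constK S w u v' = \<sigma>"
proof -
  have u: "u \<noteq> 0" and \<sigma>: "\<sigma> \<noteq> 0"
    using indep_nonzero[OF Orb_ind(2)[OF assms(1)]] by auto
  have "poly (map_poly (evL u (inverse \<sigma>)) fibre_poly) v' =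
      ev2 constK u v' (step_den S) - inverse \<sigma> * ev2 constK u v' (step_num S w)"
    by (simp add: map_fibre_poly[OF assms(1)] ev2_def)
  also have "\<dots> = ev2 constK u v' (step_den S) * inverse \<sigma> * (\<sigma> - laurent_eval constK S w u v')"
    using \<sigma> by (simp add: ev2_step_num[OF S(1) u assms(2)] field_simps)
  finally show ?thesis
    using u \<sigma> assms(2) by (auto simp: ev2_step_den)
qed

sublocale fibration Orb "\<lambda>u. evL u (inverse \<sigma>)" "\<lambda>p. evL (fst p) (snd p)" embed YL fibre_poly
proof
  fix u v assume uv: "(u, v) \<in> Orb"
  note ind = Orb_ind[OF uv]
  show "is_hom (evL u (inverse \<sigma>))"
    by (rule evL_simps(1)[OF ind(2)])
  show "evL (fst (u, v)) (snd (u, v)) (embed a) = evL u (inverse \<sigma>) a" for a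
    by (simp add: embed_def evL_lift_ev2[OF ind(1)] evL_generators[OF ind(1)] evL_laurent[OF ind(1)]
        is_hom_inverse[OF evL_simps(1)[OF ind(1)]] Orb_val[OF uv])
  show "evL (fst (u, v)) (snd (u, v)) YL = v"
    by (simp add: evL_generators[OF ind(1)])
  show v: "v \<noteq> 0"
    using indep_nonzero[OF ind(1)] by simp
  show "poly (map_poly (evL u (inverse \<sigma>)) fibre_poly) v = 0"
    using fibre_poly_root_iff[OF uv v] Orb_val[OF uv] by simp
  show "(u, v') \<in> Orb" if "poly (map_poly (evL u (inverse \<sigma>)) fibre_poly) v' = 0" "v' \<noteq> 0" for v'
    using that fibre_poly_root_iff[OF uv] Orb_fibre[OF uv] by blast
next
  show "is_hom (evL (fst p) (snd p))" if "p \<in> Orb" for p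
    using that Orb_ind(1) evL_simps(1) by (cases p) auto
  obtain u v where uv: "(u, v) \<in> Orb"
    using Orb_nonempty by auto
  have \<sigma>: "\<sigma> \<noteq> 0"
    using indep_nonzero[OF Orb_ind(2)[OF uv]] by auto
  show "fibre_poly \<noteq> 0"
  proof
    let ?m = "map_poly (\<lambda>R. poly (map_poly constK R) u)"
    assume "fibre_poly = 0"
    then have "?m (step_den S) = smult (inverse \<sigma>) (?m (step_num S w))"
      using map_fibre_poly[OF uv] by simp
    then have "smult \<sigma> (?m (step_den S)) = ?m (step_num S w)"
      using \<sigma> by simp
    then show False
      using step_fibre_nonconst[OF S indep_imp_transcendental[OF Orb_ind(2)[OF uv]]] by metis
  qed
  show "\<exists>N D. \<forall>u v. (u, v) \<in> Orb \<longrightarrow> poly (map_poly (evL u (inverse \<sigma>)) D) v \<noteq> 0 \<and>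
      evL (fst (u, v)) (snd (u, v)) r * poly (map_poly (evL u (inverse \<sigma>)) D) v =
      poly (map_poly (evL u (inverse \<sigma>)) N) v" for r
  proof (intro exI allI impI)
    fix u v assume uv: "(u, v) \<in> Orb"
    have "ev2 constK u v (snd (quot_of_fract r)) \<noteq> 0"
      using Orb_ind(1)[OF uv] by (simp add: indep_def)
    \<comment> \<open>Numerator and denominator of \<open>r\<close> are read as polynomials in Y
      over C[X]; t does not occur in them.\<close>
    then show "poly (map_poly (evL u (inverse \<sigma>)) (map_poly (\<lambda>R. to_fract [:R:]) (snd (quot_of_fract r)))) v \<noteq> 0 \<and>
      evL (fst (u, v)) (snd (u, v)) r *
        poly (map_poly (evL u (inverse \<sigma>)) (map_poly (\<lambda>R. to_fract [:R:]) (snd (quot_of_fract r)))) v =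
      poly (map_poly (evL u (inverse \<sigma>)) (map_poly (\<lambda>R. to_fract [:R:]) (fst (quot_of_fract r)))) v"
      by (simp add: evL_map_inner[OF Orb_ind(2)[OF uv]] lift_def flip: ev2_def)
  qed
  have "to_fract (of_nat n :: complex poly poly) = of_nat n" for n
    by (induction n) simp_all
  then show "of_nat (Suc n) \<noteq> (0::L)" for n
    by (metis of_nat_eq_0_iff old.nat.distinct(2) to_fract_eq_0_iff)
  show "Orb \<noteq> {}" by (rule Orb_nonempty)
qed

end

section \<open>Orthogonal decomposition along two fibrations\<close>

text \<open>More unknowns than equations: Gaussian elimination, by induction on the
  equations.\<close>

lemma homogeneous_system_solution:
  fixes f :: "'i \<Rightarrow> 'a \<Rightarrow> 'b::field"
  assumes "finite A" "finite I" "card A < card I"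
  shows "\<exists>c. (\<exists>i\<in>I. c i \<noteq> 0) \<and> (\<forall>x\<in>A. (\<Sum>i\<in>I. c i * f i x) = 0)"
  using assms
proof (induction A arbitrary: I f rule: finite_induct)
  case empty
  then have "I \<noteq> {}" by auto
  then have "\<exists>i\<in>I. (1::'b) \<noteq> 0" by auto
  then show ?case by (intro exI[of _ "\<lambda>_. 1"]) simp
next
  case (insert a A)
  show ?case
  proof (cases "\<forall>i\<in>I. f i a = 0")
    case True
    obtain c where c: "\<exists>i\<in>I. c i \<noteq> 0" "\<forall>x\<in>A. (\<Sum>i\<in>I. c i * f i x) = 0"
      using insert.IH[of I f] insert.prems insert.hyps by auto
    then show ?thesis using True by (intro exI[of _ c]) auto
  next
    case False
    then obtain k where k: "k \<in> I" "f k a \<noteq> 0" by blast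
    define g where "g i x = f i x - f i a / f k a * f k x" for i x
    have "card A < card (I - {k})"
      using insert.prems insert.hyps k(1) by simp
    then obtain c where c: "\<exists>i\<in>I - {k}. c i \<noteq> 0" "\<forall>x\<in>A. (\<Sum>i\<in>I - {k}. c i * g i x) = 0"
      using insert.IH[of "I - {k}" g] insert.prems(1) by auto
    \<comment> \<open>The eliminated unknown is recovered from equation \<open>a\<close>.\<close>
    define d where "d i = (if i = k then - (\<Sum>i\<in>I - {k}. c i * f i a) / f k a else c i)" for i
    have split: "(\<Sum>i\<in>I. d i * f i x) = (\<Sum>i\<in>I - {k}. c i * g i x)" for x
    proof -
      have "(\<Sum>i\<in>I. d i * f i x) = d k * f k x + (\<Sum>i\<in>I - {k}. d i * f i x)"
        by (rule sum.remove[OF insert.prems(1) k(1)])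
      also have "(\<Sum>i\<in>I - {k}. d i * f i x) = (\<Sum>i\<in>I - {k}. c i * f i x)"
        by (rule sum.cong) (auto simp: d_def)
      also have "d k * f k x = - (\<Sum>i\<in>I - {k}. c i * (f i a / f k a * f k x))"
        by (simp add: d_def sum_distrib_right sum_divide_distrib sum_negf mult.assoc)
      finally show ?thesis
        by (simp add: g_def algebra_simps sum_subtractf)
    qed
    have "(\<Sum>i\<in>I. d i * f i x) = 0" if "x \<in> insert a A" for x
      using that c(2) k(2) unfolding split by (auto simp: g_def)
    moreover have "\<exists>i\<in>I. d i \<noteq> 0"
      using c(1) by (auto simp: d_def)
    ultimately show ?thesis by blast
  qed
qed

section \<open>Fibre sums as symmetric positive operators\<close>

definition fibre_sum :: "'p set \<Rightarrow> ('p \<Rightarrow> 'k) \<Rightarrow> ('p \<Rightarrow> 'b::comm_monoid_add) \<Rightarrow> 'p \<Rightarrow> 'b" where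
  "fibre_sum P \<pi> f p = (\<Sum>q | q \<in> P \<and> \<pi> q = \<pi> p. f q)"

text \<open>Lying in the same fibre is a symmetric relation. The embedding \<open>e\<close> lets
  coefficients and values belong to different rings.\<close>

lemma fibre_sum_adjoint:
  assumes "finite P" "is_hom e"
  shows "(\<Sum>p\<in>P. e (fibre_sum P \<pi> f p) * h p) = (\<Sum>p\<in>P. e (f p) * fibre_sum P \<pi> h p)"
proof -
  have *: "fibre_sum P \<pi> f p = (\<Sum>q\<in>P. if \<pi> q = \<pi> p then f q else 0)" for f p
    unfolding fibre_sum_def by (rule sum.inter_filter[OF assms(1)])
  have "(\<Sum>p\<in>P. e (fibre_sum P \<pi> f p) * h p) = (\<Sum>p\<in>P. \<Sum>q\<in>P. if \<pi> q = \<pi> p then e (f q) * h p else 0)"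
    unfolding * is_hom_sum[OF assms(2)] sum_distrib_right
    by (intro sum.cong) (auto simp: is_homD(1)[OF assms(2)])
  also have "\<dots> = (\<Sum>q\<in>P. \<Sum>p\<in>P. if \<pi> q = \<pi> p then e (f q) * h p else 0)"
    by (rule sum.swap)
  also have "\<dots> = (\<Sum>q\<in>P. e (f q) * fibre_sum P \<pi> h q)"
    unfolding * sum_distrib_left by (intro sum.cong) auto
  finally show ?thesis .
qed

text \<open>Positivity: the quadratic form is a sum of squares of fibre sums.\<close>

lemma fibre_sum_quadratic:
  fixes f :: "'p \<Rightarrow> 'b::comm_ring_1"
  assumes "finite P"
  shows "(\<Sum>p\<in>P. f p * fibre_sum P \<pi> f p) = (\<Sum>k\<in>\<pi> ` P. (\<Sum>q | q \<in> P \<and> \<pi> q = k. f q)\<^sup>2)"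
proof -
  have "(\<Sum>p\<in>P. f p * fibre_sum P \<pi> f p) =
      (\<Sum>k\<in>\<pi> ` P. \<Sum>p | p \<in> P \<and> \<pi> p = k. f p * fibre_sum P \<pi> f p)"
    by (rule sum.image_gen[OF assms])
  also have "\<dots> = (\<Sum>k\<in>\<pi> ` P. \<Sum>p | p \<in> P \<and> \<pi> p = k. f p * (\<Sum>q | q \<in> P \<and> \<pi> q = k. f q))"
    unfolding fibre_sum_def by (intro sum.cong) auto
  finally show ?thesis
    by (simp add: power2_eq_square flip: sum_distrib_right)
qed

lemma fibre_sum_cong: "(\<And>q. q \<in> P \<Longrightarrow> f q = g q) \<Longrightarrow> fibre_sum P \<pi> f p = fibre_sum P \<pi> g p"
  unfolding fibre_sum_def by (intro sum.cong) auto

locale two_fibrations =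
  fixes P :: "'p set" and \<pi> :: "'p \<Rightarrow> 'k" and \<rho> :: "'p \<Rightarrow> 'l"
  assumes fin: "finite P"
begin

text \<open>The operator is polymorphic: positivity is used on real functions, rationality on
  functions with values in \<open>K\<close>.\<close>

definition J :: "('p \<Rightarrow> 'b::comm_monoid_add) \<Rightarrow> 'p \<Rightarrow> 'b" where
  "J f p = fibre_sum P \<pi> f p + fibre_sum P \<rho> f p"

lemma J_cong: "(\<And>q. q \<in> P \<Longrightarrow> f q = g q) \<Longrightarrow> J f p = J g p"
  by (simp add: J_def fibre_sum_cong[of P f g])

lemma J_zero: "J (\<lambda>_. 0) = (\<lambda>_. 0)"
  by (simp add: J_def fibre_sum_def fun_eq_iff)

lemma J_add: "J (\<lambda>p. f p + g p) = (\<lambda>p. J f p + J g p)"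
  by (simp add: J_def fibre_sum_def fun_eq_iff sum.distrib add_ac)

lemma J_pow_add: "(J ^^ n) (\<lambda>p. f p + g p) = (\<lambda>p. (J ^^ n) f p + (J ^^ n) g p)"
  by (induction n) (simp_all add: J_add)

lemma J_sum:
  fixes g :: "'i \<Rightarrow> 'p \<Rightarrow> 'b::comm_ring_1"
  shows "J (\<lambda>p. \<Sum>i\<in>I. a i * g i p) = (\<lambda>p. \<Sum>i\<in>I. a i * J (g i) p)"
proof -
  have "(\<Sum>q\<in>A. \<Sum>i\<in>I. a i * g i q) = (\<Sum>i\<in>I. a i * (\<Sum>q\<in>A. g i q))" for A
    unfolding sum_distrib_left by (rule sum.swap)
  then show ?thesis
    by (simp add: J_def fibre_sum_def fun_eq_iff distrib_left sum.distrib)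
qed

lemma J_pow_sum:
  fixes g :: "'i \<Rightarrow> 'p \<Rightarrow> 'b::comm_ring_1"
  shows "(J ^^ n) (\<lambda>p. \<Sum>i\<in>I. a i * g i p) = (\<lambda>p. \<Sum>i\<in>I. a i * (J ^^ n) (g i) p)"
  by (induction n) (simp_all add: J_sum)

lemma J_adjoint:
  assumes "is_hom e"
  shows "(\<Sum>p\<in>P. e (J f p) * h p) = (\<Sum>p\<in>P. e (f p) * J h p)"
  by (simp add: J_def is_homD(3)[OF assms] distrib_left distrib_right sum.distrib
      fibre_sum_adjoint[OF fin assms])

lemma J_pow_adjoint:
  assumes "is_hom e"
  shows "(\<Sum>p\<in>P. e ((J ^^ n) f p) * h p) = (\<Sum>p\<in>P. e (f p) * (J ^^ n) h p)"
proof (induction n arbitrary: h)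
  case (Suc n)
  have "(\<Sum>p\<in>P. e ((J ^^ Suc n) f p) * h p) = (\<Sum>p\<in>P. e ((J ^^ n) f p) * J h p)"
    by (simp add: J_adjoint[OF assms])
  also have "\<dots> = (\<Sum>p\<in>P. e (f p) * (J ^^ n) (J h) p)"
    by (rule Suc.IH)
  finally show ?case by (simp only: funpow_Suc_right o_apply)
qed simp

text \<open>By symmetry the squared norm of \<open>(J ^^ n) h\<close> is the pairing of
  \<open>(J ^^ (n - 1)) h\<close> with \<open>(J ^^ (n + 1)) h\<close>; so powers of
  \<open>J\<close> can be peeled off down to the first.\<close>

lemma J_pow_eq_0:
  fixes h :: "'p \<Rightarrow> real"
  assumes "\<And>p. p \<in> P \<Longrightarrow> (J ^^ n) h p = 0" "p \<in> P"
  shows "J h p = 0"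
  using assms
proof (induction n arbitrary: p)
  case 0
  then have "J h p = J (\<lambda>_. 0) p" by (intro J_cong) auto
  then show ?case by (simp add: J_zero)
next
  case (Suc n)
  show ?case
  proof (cases n)
    case 0
    then show ?thesis using Suc.prems by simp
  next
    case (Suc k)
    have "is_hom (\<lambda>x::real. x)" by (simp add: is_hom_def)
    from J_adjoint[OF this, of "(J ^^ k) h" "(J ^^ n) h"]
    have "(\<Sum>p\<in>P. ((J ^^ n) h p)\<^sup>2) = (\<Sum>p\<in>P. (J ^^ k) h p * (J ^^ Suc n) h p)"
      by (simp add: power2_eq_square Suc)
    also have "\<dots> = 0"
      using Suc.prems(1) by simp
    finally have "\<And>p. p \<in> P \<Longrightarrow> (J ^^ n) h p = 0"
      using fin by (simp add: sum_nonneg_eq_0_iff)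
    then show ?thesis using Suc.IH Suc.prems(2) by blast
  qed
qed

text \<open>Pairing \<open>h\<close> with \<open>J h\<close> gives the sum of the squares of all
  fibre sums of both kinds, so over the reals each is zero.\<close>

lemma J_eq_0_imp:
  fixes h :: "'p \<Rightarrow> real"
  assumes "\<And>p. p \<in> P \<Longrightarrow> J h p = 0" "p \<in> P"
  shows "fibre_sum P \<pi> h p = 0" "fibre_sum P \<rho> h p = 0"
proof -
  have "(\<Sum>p\<in>P. h p * J h p) = 0"
    using assms(1) by simp
  then have sum0: "(\<Sum>k\<in>\<pi> ` P. (\<Sum>q | q \<in> P \<and> \<pi> q = k. h q)\<^sup>2) +
      (\<Sum>k\<in>\<rho> ` P. (\<Sum>q | q \<in> P \<and> \<rho> q = k. h q)\<^sup>2) = 0"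
    by (simp add: J_def distrib_left sum.distrib fibre_sum_quadratic[OF fin])
  have nonneg: "(\<Sum>k\<in>\<pi> ` P. (\<Sum>q | q \<in> P \<and> \<pi> q = k. h q)\<^sup>2) \<ge> 0"
    "(\<Sum>k\<in>\<rho> ` P. (\<Sum>q | q \<in> P \<and> \<rho> q = k. h q)\<^sup>2) \<ge> 0"
    by (auto intro: sum_nonneg)
  have "(\<Sum>k\<in>\<pi> ` P. (\<Sum>q | q \<in> P \<and> \<pi> q = k. h q)\<^sup>2) = 0"
    using sum0 nonneg by linarith
  then show "fibre_sum P \<pi> h p = 0"
    using fin assms(2) by (simp add: sum_nonneg_eq_0_iff fibre_sum_def)
  have "(\<Sum>k\<in>\<rho> ` P. (\<Sum>q | q \<in> P \<and> \<rho> q = k. h q)\<^sup>2) = 0"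
    using sum0 nonneg by linarith
  then show "fibre_sum P \<rho> h p = 0"
    using fin assms(2) by (simp add: sum_nonneg_eq_0_iff fibre_sum_def)
qed

text \<open>The \<open>card P + 1\<close> iterates of \<open>\<delta>\<close> from exponent 0 to
  \<open>card P\<close> are linearly dependent on \<open>P\<close>; the dependency is divided by its
  lowest power of \<open>J\<close> and by the coefficient there.\<close>

lemma exists_correction:
  fixes \<delta> :: "'p \<Rightarrow> real"
  shows "\<exists>n c. \<forall>p\<in>P. J (\<lambda>p. \<delta> p - (\<Sum>i<n. c i * (J ^^ Suc i) \<delta> p)) p = 0"
proof -
  let ?N = "card P"
  obtain d where d: "\<exists>i\<in>{..?N}. d i \<noteq> 0" "\<forall>x\<in>P. (\<Sum>i\<in>{..?N}. d i * (J ^^ i) \<delta> x) = 0"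
    using homogeneous_system_solution[OF fin, of "{..?N}" "\<lambda>i. (J ^^ i) \<delta>"] by auto
  \<comment> \<open>The lowest exponent present: \<open>d j\<close> becomes the constant coefficient
    to be normalised to 1.\<close>
  define j where "j = (LEAST i. d i \<noteq> 0)"
  have j: "d j \<noteq> 0"
    unfolding j_def using d(1) LeastI_ex[of "\<lambda>i. d i \<noteq> 0"] by auto
  have less: "d i = 0" if "i < j" for i
    using that not_less_Least[of i "\<lambda>i. d i \<noteq> 0"] unfolding j_def by auto
  have jN: "j \<le> ?N"
    using d(1) less by (meson atMost_iff le_trans not_le)
  define h where "h p = (\<Sum>i\<le>?N - j. d (i + j) * (J ^^ i) \<delta> p)" for p
  have "(J ^^ j) h p = 0" if "p \<in> P" for p
  proof -
    have "(J ^^ j) h p = (\<Sum>i\<le>?N - j. d (i + j) * (J ^^ (i + j)) \<delta> p)"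
      unfolding h_def[abs_def] J_pow_sum by (simp add: add.commute[of _ j] funpow_add)
    also have "\<dots> = (\<Sum>i=j..?N. d i * (J ^^ i) \<delta> p)"
      by (rule sum.reindex_bij_witness[of _ "\<lambda>i. i - j" "\<lambda>i. i + j"]) (use jN in auto)
    also have "\<dots> = (\<Sum>i\<le>?N. d i * (J ^^ i) \<delta> p)"
      by (rule sum.mono_neutral_left) (auto simp: less)
    finally show ?thesis using d(2) that by simp
  qed
  then have Jh: "J h p = 0" if "p \<in> P" for p
    by (rule J_pow_eq_0[of j h]) (use that in auto)
  define c where "c i = - d (Suc i + j) / d j" for i
  \<comment> \<open>The one-term sum brings the scalar factor into the shape of
    \<open>J_sum\<close>.\<close>
  have eq: "\<delta> p - (\<Sum>i<?N - j. c i * (J ^^ Suc i) \<delta> p) = (\<Sum>i\<in>{()}. inverse (d j) * h p)" for p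
  proof -
    define T where "T = (\<Sum>i<?N - j. d (Suc i + j) * (J ^^ Suc i) \<delta> p)"
    have "h p = d j * \<delta> p + T"
      unfolding h_def T_def by (subst sum.atMost_shift) (simp only: funpow_0 add_0)
    moreover have "(\<Sum>i<?N - j. c i * (J ^^ Suc i) \<delta> p) = - (inverse (d j) * T)"
      unfolding T_def sum_distrib_left sum_negf[symmetric]
      by (rule sum.cong) (simp_all only: c_def divide_inverse mult_minus_left mult_ac)
    ultimately show ?thesis
      using j by (simp add: distrib_left)
  qed
  have "J (\<lambda>p. \<delta> p - (\<Sum>i<?N - j. c i * (J ^^ Suc i) \<delta> p)) p = 0" if "p \<in> P" for p
    unfolding eq using Jh[OF that] by (simp only: J_sum) simp
  then show ?thesis by blast
qed

end

section \<open>Construction of the decoupling\<close>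

lemma mem_swap_image_iff: "(v, u) \<in> prod.swap ` A \<longleftrightarrow> (u, v) \<in> A"
  by force

text \<open>A factor depending only on the fibre can be pulled out of the sum over it, leaving a
  vanishing fibre sum.\<close>

lemma sum_fibrewise_constant:
  assumes "finite P" "is_hom e" "\<And>p. p \<in> P \<Longrightarrow> fibre_sum P \<pi> f p = 0"
  shows "(\<Sum>p\<in>P. e (f p) * g (\<pi> p)) = 0"
proof -
  have "(\<Sum>p\<in>P. e (f p) * g (\<pi> p)) = (\<Sum>k\<in>\<pi> ` P. \<Sum>p | p \<in> P \<and> \<pi> p = k. e (f p) * g (\<pi> p))"
    by (rule sum.image_gen[OF assms(1)])
  also have "\<dots> = (\<Sum>k\<in>\<pi> ` P. e (\<Sum>p | p \<in> P \<and> \<pi> p = k. f p) * g k)"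
    by (intro sum.cong) (auto simp: is_hom_sum[OF assms(2)] sum_distrib_right)
  also have "\<dots> = 0"
    using assms(3) by (intro sum.neutral) (auto simp: fibre_sum_def is_homD(1)[OF assms(2)])
  finally show ?thesis .
qed

text \<open>With \<open>subfield_gen_min\<close>, this presents elements of a generated field as
  quotients of polynomials in the generators.\<close>

lemma is_subfield_quotients:
  fixes g :: "'a::comm_ring_1 \<Rightarrow> 'b::field"
  assumes "is_hom g"
  shows "is_subfield {g a / g b | a b. g b \<noteq> 0}" (is "is_subfield ?F")
proof -
  have I: "r \<in> ?F" if "r = g a / g b" "g b \<noteq> 0" for r a b
    using that by blast
  have "- r \<in> ?F \<and> inverse r \<in> ?F" if r: "r \<in> ?F" for r
  proof -
    obtain a b where ab: "r = g a / g b" "g b \<noteq> 0"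
      using r by blast
    have "- r \<in> ?F"
      by (rule I[of _ "- a" b]) (use ab in \<open>simp_all add: is_hom_uminus[OF assms]\<close>)
    moreover have "inverse r \<in> ?F"
    proof (cases "r = 0")
      case True
      then show ?thesis
        by (intro I[of _ 0 b]) (use ab in \<open>simp_all add: is_homD[OF assms]\<close>)
    next
      case False
      then show ?thesis
        by (intro I[of _ b a]) (use ab in auto)
    qed
    ultimately show ?thesis ..
  qed
  moreover have "r + s \<in> ?F \<and> r * s \<in> ?F" if rs: "r \<in> ?F" "s \<in> ?F" for r s
  proof -
    obtain a b c d where *: "r = g a / g b" "g b \<noteq> 0" "s = g c / g d" "g d \<noteq> 0"
      using rs by blast
    show ?thesis
    proof
      show "r + s \<in> ?F"
        by (rule I[of _ "a * d + c * b" "b * d"])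
          (use * in \<open>simp_all add: is_homD[OF assms] add_frac_eq\<close>)
      show "r * s \<in> ?F"
        by (rule I[of _ "a * c" "b * d"]) (use * in \<open>simp_all add: is_homD[OF assms]\<close>)
    qed
  qed
  moreover have "1 \<in> ?F"
    by (rule I[of _ 1 1]) (simp_all add: is_homD[OF assms])
  ultimately show ?thesis
    unfolding is_subfield_def by blast
qed

lemma poly3_eval_ev2: "poly3_eval P u v s = poly (map_poly (ev2 constK u v) P) s"
  by (simp add: poly3_eval_def ev2_def[abs_def])

lemma is_hom_poly3_eval: "is_hom (\<lambda>P. poly3_eval P u v s)"
  unfolding poly3_eval_ev2 by (rule is_hom_eval_map[OF is_hom_ev2[OF is_hom_constK]])

lemma poly3_eval_generators:
  "poly3_eval [:[:[:c:]:]:] u v s = constK c" "poly3_eval [:[:[:0, 1:]:]:] u v s = u"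
  "poly3_eval [:[:0, 1:]:] u v s = v" "poly3_eval [:0, 1:] u v s = s"
  by (simp_all add: poly3_eval_ev2 is_hom_map_pCons[OF is_hom_ev2[OF is_hom_constK]]
      ev2_const_const[OF is_hom_constK] ev2_X[OF is_hom_constK] ev2_Y[OF is_hom_constK]
      is_homD[OF is_hom_ev2[OF is_hom_constK]])

definition embK :: "real \<Rightarrow> K" where
  "embK r = constK (complex_of_real r)"

lemma is_hom_embK: "is_hom embK"
  unfolding embK_def by (rule is_hom_comp[OF is_hom_constK]) (simp add: is_hom_def)

section \<open>Rows and columns of a finite orbit\<close>

locale finite_walk = walk +
  assumes finite_orbit: "finite (orbit S w)"
begin

abbreviation "\<tau> \<equiv> inverse z"

lemma orbit_indep_\<tau>:
  assumes "(u, v) \<in> orbit S w"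
  shows "indep u v" "indep u \<tau>" "indep v \<tau>" "laurent_eval constK S w u v = z"
  using orbit_indep[OF assms] indep_z[of u v] by (auto intro: indep_inverse)

sublocale x_fibres: walk_fibres S w "orbit S w" z
proof
  show "\<exists>s\<in>S. snd s \<noteq> 0"
    using nonuniv by (simp add: not_univariate_def)
  show "(u, v') \<in> orbit S w" if "(u, v) \<in> orbit S w" "laurent_eval constK S w u v' = z" for u v v'
    using orbit_adj[OF that(1), of "(u, v')"] that(2) by simp
  show "orbit S w \<noteq> {}"
    using orbit_xy by blast
qed (use finite_S weights orbit_indep_\<tau> in auto)

sublocale y_fibres: walk_fibres "prod.swap ` S" "w \<circ> prod.swap" "prod.swap ` orbit S w" z
proof
  show "\<exists>s\<in>prod.swap ` S. snd s \<noteq> 0"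
    using nonuniv by (simp add: not_univariate_def)
  show "(u, v') \<in> prod.swap ` orbit S w"
    if "(u, v) \<in> prod.swap ` orbit S w"
      "laurent_eval constK (prod.swap ` S) (w \<circ> prod.swap) u v' = z" for u v v'
    using orbit_adj[of "(v, u)" "(v', u)"] that by (simp add: laurent_eval_swap mem_swap_image_iff)
  show "prod.swap ` orbit S w \<noteq> {}"
    using orbit_xy by blast
  show "laurent_eval constK (prod.swap ` S) (w \<circ> prod.swap) u v = z"
    if "(u, v) \<in> prod.swap ` orbit S w" for u v
    using that orbit_indep_\<tau>(4) by (auto simp: laurent_eval_swap)
qed (use finite_S weights in \<open>auto dest: orbit_indep_\<tau> intro: indep_commute\<close>)

sublocale two_fibrations "orbit S w" "fst" "snd"
  by unfold_locales (rule finite_orbit)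

text \<open>One \<open>r\<close> must serve all points of the orbit; this uniformity lets
  \<open>J\<close> be iterated.\<close>

definition rational :: "(K \<times> K \<Rightarrow> K) \<Rightarrow> bool" where
  "rational h \<longleftrightarrow> (\<exists>r. \<forall>p\<in>orbit S w. h p = evL (fst p) (snd p) r)"

lemma fibre_sum_fst:
  assumes "rational h"
  shows "\<exists>a. \<forall>p\<in>orbit S w. fibre_sum (orbit S w) fst h p = evL (fst p) \<tau> a"
proof -
  obtain r where r: "\<And>p. p \<in> orbit S w \<Longrightarrow> h p = evL (fst p) (snd p) r"
    using assms unfolding rational_def by blast
  obtain a where a: "\<And>u v. (u, v) \<in> orbit S w \<Longrightarrow>
      (\<Sum>v' | (u, v') \<in> orbit S w. evL (fst (u, v')) (snd (u, v')) r) = evL u \<tau> a"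
    using x_fibres.sum_over_fibre[of r] by blast
  have "fibre_sum (orbit S w) fst h p = evL (fst p) \<tau> a" if p: "p \<in> orbit S w" for p
  proof -
    have "fibre_sum (orbit S w) fst h p = (\<Sum>v' | (fst p, v') \<in> orbit S w. h (fst p, v'))"
      unfolding fibre_sum_def
      by (rule sum.reindex_bij_witness[of _ "\<lambda>v'. (fst p, v')" snd]) auto
    also have "\<dots> = evL (fst p) \<tau> a"
      using a[of "fst p" "snd p"] p by (simp add: r)
    finally show ?thesis .
  qed
  then show ?thesis by blast
qed

lemma fibre_sum_snd:
  assumes "rational h"
  shows "\<exists>a. \<forall>p\<in>orbit S w. fibre_sum (orbit S w) snd h p = evL (snd p) \<tau> a"
proof -
  obtain r where r: "\<And>p. p \<in> orbit S w \<Longrightarrow> h p = evL (fst p) (snd p) r"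
    using assms unfolding rational_def by blast
  define r' where "r' = lift (ev2 constL YL XL) r"
  obtain a where a: "\<And>v u. (v, u) \<in> prod.swap ` orbit S w \<Longrightarrow>
      (\<Sum>u' | (v, u') \<in> prod.swap ` orbit S w. evL (fst (v, u')) (snd (v, u')) r') = evL v \<tau> a"
    using y_fibres.sum_over_fibre[of r'] by blast
  have "fibre_sum (orbit S w) snd h p = evL (snd p) \<tau> a" if p: "p \<in> orbit S w" for p
  proof -
    have "fibre_sum (orbit S w) snd h p = (\<Sum>u' | (u', snd p) \<in> orbit S w. h (u', snd p))"
      unfolding fibre_sum_def
      by (rule sum.reindex_bij_witness[of _ "\<lambda>u'. (u', snd p)" fst]) auto
    also have "\<dots> = (\<Sum>u' | (u', snd p) \<in> orbit S w. evL (snd p) u' r')"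
      by (intro sum.cong) (auto simp: r r'_def evL_commute dest: orbit_indep_\<tau>(1))
    also have "\<dots> = evL (snd p) \<tau> a"
      using a[of "snd p" "fst p"] p by (simp add: mem_swap_image_iff)
    finally show ?thesis .
  qed
  then show ?thesis by blast
qed

text \<open>Row sums lie in C(u, \<open>\<tau>\<close>) and column sums in C(v,
  \<open>\<tau>\<close>); substituting 1/S(X, Y) for \<open>\<tau>\<close> makes both rational in u
  and v.\<close>

lemma rational_J:
  assumes "rational h"
  shows "rational (J h)"
proof -
  obtain a where a: "\<And>p. p \<in> orbit S w \<Longrightarrow> fibre_sum (orbit S w) fst h p = evL (fst p) \<tau> a"
    using fibre_sum_fst[OF assms] by blast
  obtain b where b: "\<And>p. p \<in> orbit S w \<Longrightarrow> fibre_sum (orbit S w) snd h p = evL (snd p) \<tau> b"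
    using fibre_sum_snd[OF assms] by blast
  \<comment> \<open>\<open>y_fibres\<close> works with exchanged coordinates; this substitution
    exchanges them back.\<close>
  let ?b = "lift (ev2 constL YL XL) (y_fibres.embed b)"
  have "J h p = evL (fst p) (snd p) (x_fibres.embed a + ?b)" if p: "p \<in> orbit S w" for p
  proof -
    obtain u v where uv: "p = (u, v)" by (cases p)
    have "(v, u) \<in> prod.swap ` orbit S w"
      using p uv by (simp add: mem_swap_image_iff)
    then have "evL v u (y_fibres.embed b) = evL v \<tau> b"
      using y_fibres.\<psi>_\<iota> by simp
    moreover have "evL u v (x_fibres.embed a) = evL u \<tau> a"
      using x_fibres.\<psi>_\<iota> p uv by simp
    moreover have ind: "indep u v"
      using p uv orbit_indep_\<tau>(1) by simp
    ultimately show ?thesis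
      using a[OF p] b[OF p]
      by (simp add: J_def uv is_homD(3)[OF evL_simps(1)[OF ind]] evL_commute indep_commute)
  qed
  then show ?thesis
    unfolding rational_def by blast
qed

lemma rational_J_pow: "rational h \<Longrightarrow> rational ((J ^^ n) h)"
  by (induction n) (simp_all add: rational_J)

text \<open>Substituting t = 1/S(X, Y) beforehand turns the evaluation at every orbit point into
  evaluation of one rational function in X and Y.\<close>

definition fracL :: "poly3 \<Rightarrow> L" where
  "fracL P = poly (map_poly (ev2 constL XL YL) P) (inverse (laurent_eval constL S w XL YL))"

lemma evL_fracL:
  assumes "p \<in> orbit S w"
  shows "evL (fst p) (snd p) (fracL P) = poly3_eval P (fst p) (snd p) \<tau>"
proof -
  obtain u v where uv: "p = (u, v)" by (cases p)
  have ind: "indep u v" and val: "laurent_eval constK S w u v = z"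
    using orbit_indep_\<tau> assms uv by auto
  note h = evL_simps(1)[OF ind]
  show ?thesis
    by (simp add: uv fracL_def poly3_eval_ev2 is_hom_poly[OF h] is_hom_inverse[OF h] evL_laurent[OF ind]
        val is_hom_map_map[OF h is_hom_ev2[OF is_hom_constL]] evL_ev2[OF ind] evL_generators[OF ind])
qed

lemma frac_eval_evL:
  assumes "p \<in> orbit S w"
  shows "frac_eval S w H p =
    evL (fst p) (snd p) (fracL (fst (quot_of_fract H)) / fracL (snd (quot_of_fract H)))"
proof -
  have "indep (fst p) (snd p)"
    using assms orbit_indep_\<tau>(1)[of "fst p" "snd p"] by simp
  then show ?thesis
    using evL_fracL[OF assms]
    by (simp add: frac_eval_def Let_def is_hom_divide[OF evL_simps(1)] flip: inverse_eq_divide)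
qed

lemma rational_frac_eval: "rational (frac_eval S w H)"
  using frac_eval_evL unfolding rational_def by blast

text \<open>
  If the denominator of \<open>F\<close> vanishes at one point of the orbit, it vanishes at all of them, and the junk
  value of \<open>frac_eval\<close> is \<open>0\<close> throughout.
\<close>

lemma frac_eval_univariate:
  assumes F: "F \<in> subfield_gen (range const3 \<union> {to_fract Z, t3})"
    and Z: "\<And>p. p \<in> orbit S w \<Longrightarrow> poly3_eval Z (fst p) (snd p) \<tau> = \<kappa> p"
      "\<And>p. p \<in> orbit S w \<Longrightarrow> indep (\<kappa> p) \<tau>"
  shows "\<exists>a. \<forall>p\<in>orbit S w. frac_eval S w F p = evL (\<kappa> p) \<tau> a"
proof -
  let ?c = "\<lambda>c::complex. [:[:[:c:]:]:]"
  have c: "is_hom ?c"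
    by (rule is_hom_comp[OF is_hom_const is_hom_comp[OF is_hom_const is_hom_const]])
  \<comment> \<open>The substitution of \<open>Z\<close> and t for the two variables; the generated
    field consists of quotients from its image.\<close>
  define g where "g = ev2 ?c Z [:0, 1:]"
  have g: "is_hom g"
    unfolding g_def by (rule is_hom_ev2[OF c])
  have gen: "g [:[:a:]:] = ?c a" "g [:[:0, 1:]:] = Z" "g [:0, 1:] = [:0, 1:]" for a
    unfolding g_def by (simp_all only: ev2_const_const[OF c] ev2_X[OF c] ev2_Y[OF c])
  have tg: "is_hom (\<lambda>P. to_fract (g P))"
    by (rule is_hom_comp[OF is_hom_to_fract g])
  have mem: "to_fract (g P) \<in> {to_fract (g a) / to_fract (g b) | a b. to_fract (g b) \<noteq> 0}" for P
    using is_homD(2)[OF g] by (intro CollectI exI[of _ P] exI[of _ 1]) simp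
  have "const3 a \<in> {to_fract (g a) / to_fract (g b) | a b. to_fract (g b) \<noteq> 0}" for a
    using mem[of "[:[:a:]:]"] unfolding gen const3_def .
  moreover have "{to_fract Z, t3} \<subseteq> {to_fract (g a) / to_fract (g b) | a b. to_fract (g b) \<noteq> 0}"
    using mem[of "[:[:0, 1:]:]"] mem[of "[:0, 1:]"] unfolding gen t3_def by blast
  ultimately have "range const3 \<union> {to_fract Z, t3} \<subseteq>
      {to_fract (g a) / to_fract (g b) | a b. to_fract (g b) \<noteq> 0}"
    by blast
  then have "F \<in> {to_fract (g a) / to_fract (g b) | a b. to_fract (g b) \<noteq> 0}"
    using subfield_gen_min[OF is_subfield_quotients[OF tg]] F by blast
  then obtain A B where AB: "F = to_fract (g A) / to_fract (g B)" "g B \<noteq> 0"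
    by auto
  then have B: "B \<noteq> 0"
    using is_homD(1)[OF g] by auto
  define N D where "N = fst (quot_of_fract F)" and "D = snd (quot_of_fract F)"
  have "to_fract N / to_fract D = to_fract (g A) / to_fract (g B)"
    using AB(1) unfolding N_def D_def by (simp only: to_fract_quot)
  moreover have "D \<noteq> 0"
    by (simp add: D_def)
  ultimately have "to_fract (N * g B) = to_fract (g A * D)"
    using AB(2) by (simp add: frac_eq_eq)
  \<comment> \<open>\<open>frac_eval\<close> uses the reduced form N/D, not known to lie in the
    image of \<open>g\<close>; this identity allows the comparison after evaluation.\<close>
  then have eq: "N * g B = g A * D"
    by (simp only: to_fract_eq_iff)
  have val: "frac_eval S w F p = (if fracL D = 0 then 0 else ev2 constK (\<kappa> p) \<tau> A / ev2 constK (\<kappa> p) \<tau> B)"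
    if p: "p \<in> orbit S w" for p
  proof -
    let ?e = "\<lambda>P. poly3_eval P (fst p) (snd p) \<tau>"
    note e = is_hom_poly3_eval[of "fst p" "snd p" \<tau>]
    have eg: "?e (g P) = ev2 constK (\<kappa> p) \<tau> P" for P
      unfolding g_def ev2_hom[OF e c] by (simp add: poly3_eval_generators Z(1)[OF p])
    have "ev2 constK (\<kappa> p) \<tau> B \<noteq> 0"
      using Z(2)[OF p] B by (simp add: indep_def)
    moreover have "?e N * ev2 constK (\<kappa> p) \<tau> B = ev2 constK (\<kappa> p) \<tau> A * ?e D"
      using arg_cong[OF eq, of ?e] by (simp only: is_homD(4)[OF e] eg)
    moreover have "?e D = 0 \<longleftrightarrow> fracL D = 0"
      using orbit_indep_\<tau>(1)[of "fst p" "snd p"] p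
      by (simp flip: evL_fracL[OF p] add: is_hom_eq_0_iff[OF evL_simps(1)])
    moreover have "frac_eval S w F p = ?e N / ?e D"
      by (simp add: frac_eval_def Let_def N_def D_def inverse_eq_divide)
    ultimately show ?thesis
      by (auto simp: frac_eq_eq)
  qed
  define a where "a = (if fracL D = 0 then 0 else to_fract A / to_fract B :: L)"
  have "frac_eval S w F p = evL (\<kappa> p) \<tau> a" if p: "p \<in> orbit S w" for p
    using val[OF p] evL_simps(3)[OF Z(2)[OF p] B] is_homD(1)[OF evL_simps(1)[OF Z(2)[OF p]]]
    by (simp add: a_def)
  then show ?thesis by blast
qed

text \<open>Evaluation at the generic point (x, y) is injective, so the equation there is an
  identity in C(X, Y) and specialises to every orbit point.\<close>

lemma galois_decoupling_on_orbit:
  assumes "galois_decoupling S w H"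
  shows "\<exists>a b. \<forall>p\<in>orbit S w. frac_eval S w H p = evL (fst p) \<tau> a + evL (snd p) \<tau> b"
proof -
  obtain F G where F: "F \<in> subfield_gen (range const3 \<union> {X3, t3})"
    and G: "G \<in> subfield_gen (range const3 \<union> {Y3, t3})"
    and FG: "frac_eval S w H (xK, yK) = frac_eval S w F (xK, yK) + frac_eval S w G (xK, yK)"
    using assms by (auto simp: galois_decoupling_def)
  obtain a where a: "\<And>p. p \<in> orbit S w \<Longrightarrow> frac_eval S w F p = evL (fst p) \<tau> a"
    using frac_eval_univariate[OF F[unfolded X3_def], of fst] orbit_indep_\<tau>(2)
    by (auto simp: poly3_eval_generators)
  obtain b where b: "\<And>p. p \<in> orbit S w \<Longrightarrow> frac_eval S w G p = evL (snd p) \<tau> b"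
    using frac_eval_univariate[OF G[unfolded Y3_def], of snd] orbit_indep_\<tau>(3)
    by (auto simp: poly3_eval_generators)
  define f where "f H = fracL (fst (quot_of_fract H)) / fracL (snd (quot_of_fract H))" for H
  have eval: "frac_eval S w H p = evL (fst p) (snd p) (f H)" if "p \<in> orbit S w" for p H
    using frac_eval_evL[OF that] by (simp add: f_def)
  have hom: "is_hom (evL (fst p) (snd p))" if "p \<in> orbit S w" for p
    using orbit_indep_\<tau>(1)[of "fst p" "snd p"] that evL_simps(1) by simp
  have "f H = f F + f G"
    using FG unfolding eval[OF orbit_xy] is_homD(3)[OF hom[OF orbit_xy], symmetric]
      is_hom_eq_iff[OF hom[OF orbit_xy]] .
  then have "frac_eval S w H p = evL (fst p) \<tau> a + evL (snd p) \<tau> b" if "p \<in> orbit S w" for p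
    using a[OF that] b[OF that] eval[OF that] is_homD(3)[OF hom[OF that]] by simp
  then show ?thesis by blast
qed

text \<open>The base field contains \<open>z\<close>, hence \<open>\<tau>\<close>, so C(u,
  \<open>\<tau>\<close>) lies in k(u).\<close>

lemma evL_in_subfield:
  assumes "u \<in> subfield_gen (base_field S w \<union> {u})"
  shows "evL u \<tau> a \<in> subfield_gen (base_field S w \<union> {u})" (is "_ \<in> ?F")
proof -
  have F: "is_subfield ?F"
    by (rule is_subfield_subfield_gen)
  have "range constK \<union> {z} \<subseteq> base_field S w"
    unfolding base_field_def by (rule subfield_gen_incl)
  also have "\<dots> \<subseteq> ?F"
    using subfield_gen_incl by blast
  finally have gen: "constK c \<in> ?F" "z \<in> ?F" for c
    by auto
  have inner: "poly (map_poly constK R) u \<in> ?F" for R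
    by (rule is_subfield_poly[OF F assms]) (simp only: coeff_map_poly is_homD(1)[OF is_hom_constK] gen)
  have "ev2 constK u \<tau> P \<in> ?F" for P
    unfolding ev2_def
    by (rule is_subfield_poly[OF F is_subfieldD(4)[OF F gen(2)]])
      (simp only: coeff_map_poly is_homD(1)[OF is_hom_ev_inner] inner)
  then show ?thesis
    unfolding lift_def by (intro is_subfield_divide[OF F])
qed

text \<open>The cut-off matters: \<open>J\<close> can be nonzero at a point outside the orbit that
  shares a coordinate with one inside.\<close>

definition chain :: "(K \<times> K \<Rightarrow> real) \<Rightarrow> ((K \<times> K) \<Rightarrow>\<^sub>0 complex)" where
  "chain f = Abs_poly_mapping (\<lambda>p. if p \<in> orbit S w then complex_of_real (f p) else 0)"

lemma lookup_chain:
  "Poly_Mapping.lookup (chain f) p = (if p \<in> orbit S w then complex_of_real (f p) else 0)"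
proof -
  have "{p. (if p \<in> orbit S w then complex_of_real (f p) else 0) \<noteq> 0} \<subseteq> orbit S w"
    by (auto split: if_splits)
  then have "finite {p. (if p \<in> orbit S w then complex_of_real (f p) else 0) \<noteq> 0}"
    using finite_orbit by (rule finite_subset)
  then show ?thesis
    by (simp add: chain_def Abs_poly_mapping_inverse)
qed

lemma keys_chain: "Poly_Mapping.keys (chain f) \<subseteq> orbit S w"
  by (auto simp: in_keys_iff lookup_chain split: if_splits)

lemma chain_eval_chain:
  "chain_eval S w H (chain f) = (\<Sum>p\<in>orbit S w. embK (f p) * frac_eval S w H p)"
proof -
  have "chain_eval S w H (chain f) =
      (\<Sum>p\<in>orbit S w. constK (Poly_Mapping.lookup (chain f) p) * frac_eval S w H p)"
    unfolding chain_eval_def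
    by (rule sum.mono_neutral_left[OF finite_orbit keys_chain])
      (simp add: in_keys_iff is_homD(1)[OF is_hom_constK])
  then show ?thesis
    by (simp add: lookup_chain embK_def)
qed

theorem decoupling_exists: "\<exists>\<gamma>x \<gamma>y \<alpha>. decoupling S w \<gamma>x \<gamma>y \<alpha>"
proof -
  let ?O = "orbit S w"
  define \<delta> :: "K \<times> K \<Rightarrow> real" where "\<delta> p = (if p = (xK, yK) then 1 else 0)" for p
  obtain n c where nc: "\<And>p. p \<in> ?O \<Longrightarrow> J (\<lambda>p. \<delta> p - (\<Sum>i<n. c i * (J ^^ Suc i) \<delta> p)) p = 0"
    using exists_correction[of \<delta>] by blast
  define \<alpha> where "\<alpha> p = \<delta> p - (\<Sum>i<n. c i * (J ^^ Suc i) \<delta> p)" for p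
  define \<gamma> where "\<gamma> \<pi> p = (\<Sum>i<n. c i * (J ^^ i) (fibre_sum ?O \<pi> \<delta>) p)" for \<pi> :: "K \<times> K \<Rightarrow> K" and p
  have "J \<alpha> p = 0" if "p \<in> ?O" for p
    using nc[OF that] by (simp only: \<alpha>_def[abs_def])
  note \<alpha>0 = J_eq_0_imp[of \<alpha>, OF this]
  \<comment> \<open>The innermost \<open>J\<close> is split into its row and column parts; this
    divides the correction into the two chains.\<close>
  have "(J ^^ Suc i) \<delta> p = (J ^^ i) (fibre_sum ?O fst \<delta>) p + (J ^^ i) (fibre_sum ?O snd \<delta>) p" for i p
  proof -
    have "(J ^^ Suc i) \<delta> = (J ^^ i) (\<lambda>p. fibre_sum ?O fst \<delta> p + fibre_sum ?O snd \<delta> p)"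
      by (simp only: funpow_Suc_right o_apply J_def[abs_def])
    then show ?thesis
      by (simp only: J_pow_add)
  qed
  then have "\<delta> p = \<gamma> fst p + \<gamma> snd p + \<alpha> p" for p
    by (simp add: \<alpha>_def \<gamma>_def distrib_left sum.distrib del: funpow.simps)
  moreover have "complex_of_real (\<delta> p) = (if p = (xK, yK) then 1 else 0)" for p
    by (simp add: \<delta>_def)
  ultimately have split: "Poly_Mapping.single (xK, yK) 1 = chain (\<gamma> fst) + chain (\<gamma> snd) + chain \<alpha>"
    using orbit_xy
    by (intro poly_mapping_eqI) (auto simp: lookup_add lookup_chain lookup_single when_def simp flip: of_real_add)
  have \<gamma>_eval: "chain_eval S w H (chain (\<gamma> \<pi>)) =
      (\<Sum>i<n. embK (c i) * fibre_sum ?O \<pi> ((J ^^ i) (frac_eval S w H)) (xK, yK))" for H \<pi>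
  proof -
    let ?h = "frac_eval S w H"
    \<comment> \<open>Transposition reverses the order: the fibre sum, innermost in
      \<open>\<gamma>\<close>, becomes outermost and so gives a value depending on one coordinate
      and \<open>\<tau>\<close> only.\<close>
    have "(\<Sum>p\<in>?O. embK ((J ^^ i) (fibre_sum ?O \<pi> \<delta>) p) * ?h p) =
        fibre_sum ?O \<pi> ((J ^^ i) ?h) (xK, yK)" for i
    proof -
      have "(\<Sum>p\<in>?O. embK ((J ^^ i) (fibre_sum ?O \<pi> \<delta>) p) * ?h p) =
          (\<Sum>p\<in>?O. embK (\<delta> p) * fibre_sum ?O \<pi> ((J ^^ i) ?h) p)"
        by (simp only: J_pow_adjoint[OF is_hom_embK] fibre_sum_adjoint[OF finite_orbit is_hom_embK])
      also have "\<dots> = (\<Sum>p\<in>?O. if p = (xK, yK) then fibre_sum ?O \<pi> ((J ^^ i) ?h) p else 0)"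
        by (intro sum.cong) (auto simp: \<delta>_def is_homD[OF is_hom_embK])
      also have "\<dots> = fibre_sum ?O \<pi> ((J ^^ i) ?h) (xK, yK)"
        using orbit_xy finite_orbit by simp
      finally show ?thesis .
    qed
    moreover have "chain_eval S w H (chain (\<gamma> \<pi>)) =
        (\<Sum>i<n. embK (c i) * (\<Sum>p\<in>?O. embK ((J ^^ i) (fibre_sum ?O \<pi> \<delta>) p) * ?h p))"
      unfolding chain_eval_chain \<gamma>_def is_hom_sum[OF is_hom_embK] is_homD(4)[OF is_hom_embK]
        sum_distrib_right sum_distrib_left mult.assoc
      by (rule sum.swap)
    ultimately show ?thesis by simp
  qed
  have const: "embK r \<in> subfield_gen (base_field S w \<union> U)" for r U
    using subfield_gen_incl[of "range constK \<union> {z}"] subfield_gen_incl[of "base_field S w \<union> U"]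
    by (auto simp: base_field_def embK_def)
  have "decoupling S w (chain (\<gamma> fst)) (chain (\<gamma> snd)) (chain \<alpha>)"
    unfolding decoupling_def zero_chains_def
  proof (intro conjI allI impI CollectI keys_chain split)
    fix H
    have rat: "rational ((J ^^ i) (frac_eval S w H))" for i
      by (rule rational_J_pow[OF rational_frac_eval])
    have gen: "u \<in> subfield_gen (base_field S w \<union> {u})" for u
      using subfield_gen_incl by blast
    have "fibre_sum ?O fst ((J ^^ i) (frac_eval S w H)) (xK, yK) \<in> subfield_gen (base_field S w \<union> {xK})" for i
      using fibre_sum_fst[OF rat[of i]] orbit_xy evL_in_subfield[OF gen] by fastforce
    then show "chain_eval S w H (chain (\<gamma> fst)) \<in> subfield_gen (base_field S w \<union> {xK})"
      unfolding \<gamma>_eval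
      by (intro is_subfield_sum[OF is_subfield_subfield_gen] is_subfieldD(6)[OF is_subfield_subfield_gen] const)
    have "fibre_sum ?O snd ((J ^^ i) (frac_eval S w H)) (xK, yK) \<in> subfield_gen (base_field S w \<union> {yK})" for i
      using fibre_sum_snd[OF rat[of i]] orbit_xy evL_in_subfield[OF gen] by fastforce
    then show "chain_eval S w H (chain (\<gamma> snd)) \<in> subfield_gen (base_field S w \<union> {yK})"
      unfolding \<gamma>_eval
      by (intro is_subfield_sum[OF is_subfield_subfield_gen] is_subfieldD(6)[OF is_subfield_subfield_gen] const)
    assume "galois_decoupling S w H"
    then obtain a b where ab: "\<And>p. p \<in> ?O \<Longrightarrow> frac_eval S w H p = evL (fst p) \<tau> a + evL (snd p) \<tau> b"
      using galois_decoupling_on_orbit by blast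
    have "chain_eval S w H (chain \<alpha>) =
        (\<Sum>p\<in>?O. embK (\<alpha> p) * evL (fst p) \<tau> a) + (\<Sum>p\<in>?O. embK (\<alpha> p) * evL (snd p) \<tau> b)"
      by (simp add: chain_eval_chain ab distrib_left sum.distrib)
    then show "chain_eval S w H (chain \<alpha>) = 0"
      using sum_fibrewise_constant[OF finite_orbit is_hom_embK \<alpha>0(1), of "\<lambda>u. evL u \<tau> a"]
        sum_fibrewise_constant[OF finite_orbit is_hom_embK \<alpha>0(2), of "\<lambda>v. evL v \<tau> b"]
      by simp
  qed
  then show ?thesis by blast
qed

end

theorem theorem21:
  fixes S :: "(int \<times> int) set" and w :: "int \<times> int \<Rightarrow> complex"
  assumes "finite S"
    and "\<forall>s\<in>S. w s \<noteq> 0"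
    and "not_univariate S"
    and "finite (orbit S w)"
  shows "\<exists>\<gamma>x \<gamma>y \<alpha>. decoupling S w \<gamma>x \<gamma>y \<alpha>"
proof -
  interpret finite_walk S w
    by unfold_locales (fact assms)+
  show ?thesis
    by (rule decoupling_exists)
qed

end
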